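(* Let $P\in S_n$ be a permutation and $\mathcal{T}$ any block decomposition tree of $P$. Then the cost of \textsc{RGreedy} run on $P$ with $\mathcal{T}$ satisfies \[\textsc{RGreedy}(P)\le 4\sum_{\tilde P\in N(\mathcal{T})}\textsc{Greedy}(\tilde P)+\sum_{Q\in L(\mathcal{T})}\textsc{Greedy}(Q)+3n,\] where the first sum is over the skeletons of non-leaf nodes and the second over the permutations associated with leaf nodes.
   Context: Geometric model: $P=(x_1,\dots,x_n)$ is the set of access points $\{(x_t,t)\}$ (key, time). $\square_{pq}$ is the closed rectangle with corners $p,q$. \textsc{Greedy} without initial tree: let $\tau(b,t)$ be the largest time $\le t$ at which column $b$ has an output point; at time $t$ with access $(a,t)$, add $(a,t)$ and $(b,t)$ for each $b\ne a$ with $\tau(b,t-1)$ defined such that $\square_{(a,t),(b,\tau(b,t-1))}$ contains no output point at times $<t$ except $(b,\tau(b,t-1))$. For a permutation $Q$, $\textsc{Greedy}(Q)$ is the number of output points of \textsc{Greedy} on $Q$. Blocks: a time interval $[a,b]$ with $\{x_a,\dots,x_b\}=[c,d]$ an interval of keys; the block is the square region $[c,d]\times[a,b]$. A block decomposition tree $\mathcal{T}$ is a rooted tree of blocks with root $[n]\times[n]$, in which every node is a leaf or has children $P_1,\dots,P_k$ ($k\ge2$), blocks whose time intervals partition the node's time interval into consecutive intervals, indexed in increasing time. The skeleton $\tilde P\in S_k$ of a non-leaf node is the permutation order-isomorphic to $(r_1,\dots,r_k)$ with $r_j$ any key of $P_j$; a leaf is associated with the permutation order-isomorphic to its restriction of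 $P$. $N(\mathcal{T})$, $L(\mathcal{T})$: non-leaf and leaf nodes. For a non-leaf node with children $P_1,\dots,P_k$ let $I_1<\dots<I_k$ be the key intervals of the children sorted left to right and $J_j$ the time interval of $P_j$; the regions are $R(i,j)=I_i\times J_j$. For a region $R$ at a given moment, $\mathrm{topleft}(R)$ / $\mathrm{topright}(R)$ are (leftmost key, top time) / (rightmost key, top time) of $R$; $\mathrm{topwing}(R)$ is the set of points $q$ of the current output lying in $R$ that are the topmost output points of their column within $R$ and such that $\square_{q,\mathrm{topleft}(R)}$ or $\square_{q,\mathrm{topright}(R)}$ contains no current output point other than $q$, or $q$ lies in the leftmost or rightmost column of $R$. \textsc{RGreedy} (offline, uses $\mathcal{T}$, no initial tree): at each time $t=1,\dots,n$ with access $(a,t)$, first add the points \textsc{Greedy} would add. Then let $v_1$ (a leaf), $v_2=\mathrm{parent}(v_1),\dots,v_\ell$ be the nodes whose blocks end at time $t$, and $v_{\ell+1}=\mathrm{parent}(v_\ell)$ if it exists. For $h=2,\dots,\ell+1$ in increasing order: with children $P_1,\dots,P_k$ of $v_h$ and $(a,t)\in P_j$, for every $i\in[k]$ add $(q.x,t)$ for every $q\in\mathrm{topwing}(R(i,j))$ (computed with the current output). $\textsc{RGreedy}(P)$ is the total number of output points. *)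

theory Defs
  imports "HOL-Combinatorics.Combinatorics"
begin

text \<open>
  A point is a pair (key, time). Permutations in \<open>S\<^sub>n\<close> are given in one-line notation as elements of
  \<^term>\<open>permutations_of_set {1..n}\<close>; times run from 1 to n, so the key accessed at time t is
  the list entry with index t - 1.
\<close>

type_synonym point = "nat \<times> nat"

definition access :: "nat list \<Rightarrow> nat \<Rightarrow> nat" where
  "access P t = P ! (t - 1)"

definition rect :: "point \<Rightarrow> point \<Rightarrow> point set" where
  "rect p q = {min (fst p) (fst q)..max (fst p) (fst q)} \<times> {min (snd p) (snd q)..max (snd p) (snd q)}"

definition pattern :: "nat list \<Rightarrow> nat list" where
  "pattern rs = map (\<lambda>r. card {s \<in> set rs. s \<le> r}) rs"


subsection \<open>Greedy without initial tree\<close>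

definition \<tau>_defined :: "point set \<Rightarrow> nat \<Rightarrow> nat \<Rightarrow> bool" where
  "\<tau>_defined S b t \<longleftrightarrow> (\<exists>s\<le>t. (b, s) \<in> S)"

definition \<tau> :: "point set \<Rightarrow> nat \<Rightarrow> nat \<Rightarrow> nat" where
  "\<tau> S b t = Max {s. s \<le> t \<and> (b, s) \<in> S}"

definition greedy_points :: "point set \<Rightarrow> nat \<Rightarrow> nat \<Rightarrow> point set" where
  "greedy_points S a t = insert (a, t)
     {(b, t) | b. b \<noteq> a \<and> \<tau>_defined S b (t - 1) \<and>
        {z \<in> S. snd z < t} \<inter> rect (a, t) (b, \<tau> S b (t - 1)) \<subseteq> {(b, \<tau> S b (t - 1))}}"

fun greedy_output :: "nat list \<Rightarrow> nat \<Rightarrow> point set" where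
  "greedy_output P 0 = {}"
| "greedy_output P (Suc t) =
     (let S = greedy_output P t in S \<union> greedy_points S (access P (Suc t)) (Suc t))"

definition greedy :: "nat list \<Rightarrow> nat" where
  "greedy P = card (greedy_output P (length P))"


subsection \<open>Block decomposition trees\<close>

text \<open>A node stores the time interval of its block; its key interval is determined by \<open>P\<close>.\<close>

datatype block_tree =
  Node (first_time: nat) (last_time: nat) (children: "block_tree list")

definition times :: "block_tree \<Rightarrow> nat set" where
  "times v = {first_time v..last_time v}"

definition keys :: "nat list \<Rightarrow> block_tree \<Rightarrow> nat set" where
  "keys P v = access P ` times v"

definition block :: "nat list \<Rightarrow> block_tree \<Rightarrow> point set" where
  "block P v = keys P v \<times> times v"

definition is_block :: "nat list \<Rightarrow> block_tree \<Rightarrow> bool" where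
  "is_block P v \<longleftrightarrow> 1 \<le> first_time v \<and> first_time v \<le> last_time v \<and> last_time v \<le> length P \<and>
     (\<exists>c d. keys P v = {c..d})"

definition partitions_times :: "block_tree list \<Rightarrow> block_tree \<Rightarrow> bool" where
  "partitions_times vs v \<longleftrightarrow> vs \<noteq> [] \<and>
     first_time (hd vs) = first_time v \<and> last_time (last vs) = last_time v \<and>
     (\<forall>i. Suc i < length vs \<longrightarrow> first_time (vs ! Suc i) = Suc (last_time (vs ! i)))"

text \<open>All nodes of a tree in preorder.\<close>

primrec nodes :: "block_tree \<Rightarrow> block_tree list" where
  "nodes (Node a b vs) = Node a b vs # concat (map nodes vs)"

definition is_leaf :: "block_tree \<Rightarrow> bool" where
  "is_leaf v \<longleftrightarrow> children v = []"

definition block_decomposition_tree :: "nat list \<Rightarrow> block_tree \<Rightarrow> bool" where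
  "block_decomposition_tree P T \<longleftrightarrow> first_time T = 1 \<and> last_time T = length P \<and>
     (\<forall>v \<in> set (nodes T). is_block P v \<and>
        (is_leaf v \<or> length (children v) \<ge> 2 \<and> partitions_times (children v) v))"

definition non_leaf_nodes :: "block_tree \<Rightarrow> block_tree list" where
  "non_leaf_nodes T = filter (\<lambda>v. \<not> is_leaf v) (nodes T)"

definition leaf_nodes :: "block_tree \<Rightarrow> block_tree list" where
  "leaf_nodes T = filter is_leaf (nodes T)"

text \<open>
  The children of a node have pairwise disjoint key intervals, so the skeleton does not depend on which
  key represents a child; we take the smallest one.
\<close>

definition skeleton :: "nat list \<Rightarrow> block_tree \<Rightarrow> nat list" where
  "skeleton P v = pattern (map (\<lambda>c. Min (keys P c)) (children v))"

definition leaf_perm :: "nat list \<Rightarrow> block_tree \<Rightarrow> nat list" where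
  "leaf_perm P v = pattern (map (access P) [first_time v..<Suc (last_time v)])"


subsection \<open>RGreedy\<close>

text \<open>The indices \<open>i\<close> and \<open>j\<close> of the regions \<open>R(i,j)\<close> are counted from 0.\<close>

definition key_interval :: "nat list \<Rightarrow> block_tree \<Rightarrow> nat \<Rightarrow> nat set" where
  "key_interval P v i = keys P (sort_key (\<lambda>c. Min (keys P c)) (children v) ! i)"

definition region :: "nat list \<Rightarrow> block_tree \<Rightarrow> nat \<Rightarrow> nat \<Rightarrow> point set" where
  "region P v i j = key_interval P v i \<times> times (children v ! j)"

definition topleft :: "point set \<Rightarrow> point" where
  "topleft R = (Min (fst ` R), Max (snd ` R))"

definition topright :: "point set \<Rightarrow> point" where
  "topright R = (Max (fst ` R), Max (snd ` R))"

definition topwing :: "point set \<Rightarrow> point set \<Rightarrow> point set" where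
  "topwing S R = {q \<in> S \<inter> R.
     (\<forall>z \<in> S \<inter> R. fst z = fst q \<longrightarrow> snd z \<le> snd q) \<and>
     (S \<inter> rect q (topleft R) \<subseteq> {q} \<or> S \<inter> rect q (topright R) \<subseteq> {q} \<or>
      fst q = fst (topleft R) \<or> fst q = fst (topright R))}"

text \<open>
  The points for all \<open>i\<close> are added simultaneously: the regions \<open>R(i,j)\<close> with fixed \<open>j\<close> have disjoint sets
  of columns, so points added for one of them do not affect the top wings of the others.
\<close>

definition add_topwings :: "nat list \<Rightarrow> nat \<Rightarrow> block_tree \<Rightarrow> point set \<Rightarrow> point set" where
  "add_topwings P t v S =
     (let k = length (children v);
          j = (THE j. j < k \<and> (access P t, t) \<in> block P (children v ! j))
      in S \<union> (\<Union>i<k. (\<lambda>q. (fst q, t)) ` topwing S (region P v i j)))"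

text \<open>
  In a block decomposition tree, the nodes whose time interval contains \<open>t\<close> form the path from the root
  to the leaf containing time \<open>t\<close>, and preorder lists them from the root downwards.
\<close>

definition leaf_to_root_path :: "block_tree \<Rightarrow> nat \<Rightarrow> block_tree list" where
  "leaf_to_root_path T t = rev (filter (\<lambda>v. t \<in> times v) (nodes T))"

text \<open>
  The nodes \<open>v\<^sub>1, \<dots>, v\<^sub>l\<close> whose blocks end at time \<open>t\<close> form an initial segment of this path. The following
  list is \<open>v\<^sub>2, \<dots>, v\<^sub>l, v\<^sub>l\<^sub>+\<^sub>1\<close>, where \<open>v\<^sub>l\<^sub>+\<^sub>1\<close> is missing if \<open>v\<^sub>l\<close> is the root; it is empty
  if no block ends at time \<open>t\<close>.
\<close>

definition processed_nodes :: "block_tree \<Rightarrow> nat \<Rightarrow> block_tree list" where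
  "processed_nodes T t =
     (let vs = leaf_to_root_path T t;
          l = length (takeWhile (\<lambda>v. last_time v = t) vs)
      in take l (tl vs))"

fun rgreedy_output :: "nat list \<Rightarrow> block_tree \<Rightarrow> nat \<Rightarrow> point set" where
  "rgreedy_output P T 0 = {}"
| "rgreedy_output P T (Suc t) =
     (let S = rgreedy_output P T t
      in fold (add_topwings P (Suc t)) (processed_nodes T (Suc t))
           (S \<union> greedy_points S (access P (Suc t)) (Suc t)))"

definition rgreedy :: "nat list \<Rightarrow> block_tree \<Rightarrow> nat" where
  "rgreedy P T = card (rgreedy_output P T (length P))"

end

theory Submission
  imports Defs
begin

text \<open>
  When a child block ends, its outermost columns are raised to its last time, so from then on only
  these two columns of the child can be touched. Hence a point whose column and time
  separate only below a non-leaf node lies in an outermost column of some child, and the regions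
  of that node that receive points are exactly those in which Greedy touches the skeleton. Such a
  region receives at most two points when its time interval starts and two when it ends, and each
  column interval at most two more when the whole node ends; the latter are paid by the access
  points of the skeleton. After the first access inside a block, Greedy can touch at most one column
  on each side outside the block, which costs 2n in total. Inside a leaf block
  RGreedy acts as Greedy, except at the last time of the block, which costs another n.
\<close>

subsection \<open>Greedy\<close>

text \<open>Several nodes may add top wings at the same time, each seeing what the previous ones
  added, and the output at such an intermediate moment is never described exactly. The proof only
  uses that it contains every point of earlier times and all Greedy points of the current time, and
  that it is contained in the final output. Since \<open>touches\<close> reads only times before the
  current one, all statements can then be made about the final output. The skeleton has a single row
  per child, whereas a region may carry points at many times of its row. A point of one region hides
  a point of another region in the same row only if it is not older. The top wing of a nonempty
  region is nonempty, so every reached region gets a point at the last time of its row; that point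
  is late enough to hide anything in its row, and this makes the comparison with the skeleton
  faithful. Both outermost columns of an ended child must be raised because later accesses may come
  from either side.\<close>

text \<open>
  The time \<open>s\<close> below is necessarily \<open>\<tau> S b (t - 1)\<close>: a later point of column \<open>b\<close> would
  lie in the rectangle.
\<close>

definition touches :: "point set \<Rightarrow> nat \<Rightarrow> nat \<Rightarrow> nat \<Rightarrow> bool" where
  "touches S a t b \<longleftrightarrow> (\<exists>s<t. (b, s) \<in> S \<and>
     (\<forall>x y. (x, y) \<in> S \<longrightarrow> s \<le> y \<longrightarrow> y < t \<longrightarrow> min a b \<le> x \<longrightarrow> x \<le> max a b \<longrightarrow> x = b \<and> y = s))"

lemma touches_cong:
  assumes "\<And>x y. y < t \<Longrightarrow> (x, y) \<in> S \<longleftrightarrow> (x, y) \<in> S'"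
  shows "touches S a t b \<longleftrightarrow> touches S' a t b"
  unfolding touches_def using assms by blast

lemma greedy_points_iff:
  assumes "1 \<le> t"
  shows "(b, u) \<in> greedy_points S a t \<longleftrightarrow> u = t \<and> (b = a \<or> touches S a t b)"
proof -
  have "touches S a t b \<longleftrightarrow> \<tau>_defined S b (t - 1) \<and>
        {z \<in> S. snd z < t} \<inter> rect (a, t) (b, \<tau> S b (t - 1)) \<subseteq> {(b, \<tau> S b (t - 1))}" (is "_ \<longleftrightarrow> ?R")
  proof
    assume "touches S a t b"
    then obtain s where s: "s < t" "(b, s) \<in> S"
      and only: "\<And>x y. (x, y) \<in> S \<Longrightarrow> s \<le> y \<Longrightarrow> y < t \<Longrightarrow> min a b \<le> x \<Longrightarrow> x \<le> max a b \<Longrightarrow> x = b \<and> y = s"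
      unfolding touches_def by blast
    have "\<tau> S b (t - 1) = s"
      unfolding \<tau>_def
    proof (rule Max_eqI)
      fix s' assume "s' \<in> {s. s \<le> t - 1 \<and> (b, s) \<in> S}"
      then show "s' \<le> s" using only[of b s'] assms by (cases "s \<le> s'") auto
    qed (use s in auto)
    moreover have "\<tau>_defined S b (t - 1)"
      unfolding \<tau>_defined_def using s by (intro exI[of _ s]) auto
    ultimately show ?R using only s by (auto simp: rect_def)
  next
    assume R: ?R
    define s where "s = \<tau> S b (t - 1)"
    have "s \<in> {s. s \<le> t - 1 \<and> (b, s) \<in> S}"
      unfolding s_def \<tau>_def using R by (intro Max_in) (auto simp: \<tau>_defined_def)
    then have "s < t" "(b, s) \<in> S" using assms by auto
    moreover have "x = b \<and> y = s"
      if "(x, y) \<in> S" "s \<le> y" "y < t" "min a b \<le> x" "x \<le> max a b" for x y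
    proof -
      have "(x, y) \<in> {z \<in> S. snd z < t} \<inter> rect (a, t) (b, s)"
        using that by (auto simp: rect_def)
      then show ?thesis using R unfolding s_def by blast
    qed
    ultimately show "touches S a t b" unfolding touches_def by blast
  qed
  then show ?thesis unfolding greedy_points_def by auto
qed

lemma greedy_output_subset: "t \<le> length P \<Longrightarrow> greedy_output P t \<subseteq> set P \<times> {1..t}"
proof (induction t)
  case (Suc t)
  have "access P (Suc t) \<in> set P" using Suc.prems by (simp add: access_def)
  then show ?case using Suc
    by (auto simp: Let_def greedy_points_iff touches_def)
qed simp

lemma greedy_output_Suc_iff:
  "(b, u) \<in> greedy_output P (Suc t) \<longleftrightarrow>
     (b, u) \<in> greedy_output P t \<or>
     u = Suc t \<and> (b = access P (Suc t) \<or> touches (greedy_output P t) (access P (Suc t)) (Suc t) b)"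
  by (simp add: Let_def greedy_points_iff)

lemma greedy_output_restrict:
  assumes "m \<le> length P" "t \<le> m"
  shows "(b, t) \<in> greedy_output P m \<longleftrightarrow> (b, t) \<in> greedy_output P t"
  using assms
proof (induction m)
  case (Suc m)
  show ?case
  proof (cases "t = Suc m")
    case False
    then show ?thesis using Suc by (simp add: greedy_output_Suc_iff del: greedy_output.simps)
  qed simp
qed simp

text \<open>Turns the recursion into an equation about the final output. This is legitimate because
  a touch at time \<open>t\<close> depends only on points of earlier times, which later steps never
  change.\<close>

lemma greedy_output_iff:
  assumes "1 \<le> t" "t \<le> length P"
  defines "S \<equiv> greedy_output P (length P)"
  shows "(b, t) \<in> S \<longleftrightarrow> b = access P t \<or> touches S (access P t) t b"
proof -
  obtain m where m: "t = Suc m" using assms by (cases t) auto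
  have "(b, t) \<notin> greedy_output P m"
    using greedy_output_subset[of m P] assms m by auto
  then have "(b, t) \<in> S \<longleftrightarrow> b = access P t \<or> touches (greedy_output P m) (access P t) t b"
    unfolding S_def using assms m
    by (simp add: greedy_output_restrict[of "length P" P] greedy_output_Suc_iff del: greedy_output.simps)
  also have "touches (greedy_output P m) (access P t) t b \<longleftrightarrow> touches S (access P t) t b"
  proof (rule touches_cong)
    fix x y assume "y < t"
    then show "(x, y) \<in> greedy_output P m \<longleftrightarrow> (x, y) \<in> S"
      unfolding S_def using assms m
      by (simp add: greedy_output_restrict[of "length P" P y] greedy_output_restrict[of m P y])
  qed
  finally show ?thesis .
qed

text \<open>Greedy only compares keys, so a relabelling that preserves their order carries one
  output onto the other. The induction is on time, as touches at \<open>t\<close> are decided by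
  earlier points.\<close>

lemma greedy_map:
  assumes "strict_mono_on (set P) f"
  shows "greedy (map f P) = greedy P"
proof -
  define S where "S = greedy_output P (length P)"
  define S' where "S' = greedy_output (map f P) (length P)"
  have sub: "S \<subseteq> set P \<times> {1..length P}" "S' \<subseteq> f ` set P \<times> {1..length P}"
    using greedy_output_subset[of "length P" P] greedy_output_subset[of "length P" "map f P"]
    by (auto simp: S_def S'_def)
  have le: "f x \<le> f y \<longleftrightarrow> x \<le> y" if "x \<in> set P" "y \<in> set P" for x y
    using strict_mono_on_leD[OF assms] strict_mono_onD[OF assms] that by (metis linorder_not_less)
  have inj: "inj_on f (set P)" using assms by (rule strict_mono_on_imp_inj_on)
  have main: "(f b, t) \<in> S' \<longleftrightarrow> (b, t) \<in> S" if "b \<in> set P" for b t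
    using that
  proof (induction t arbitrary: b rule: less_induct)
    case (less t)
    show ?case
    proof (cases "1 \<le> t \<and> t \<le> length P")
      case False
      then show ?thesis using sub by fastforce
    next
      case True
      define a where "a = access P t"
      have a: "a \<in> set P" "access (map f P) t = f a"
        using True by (auto simp: a_def access_def)
      have "touches S' (f a) t (f b) \<longleftrightarrow> touches S a t b"
      proof
        assume "touches S' (f a) t (f b)"
        then obtain s where s: "s < t" "(f b, s) \<in> S'"
          and only: "\<And>x y. (x, y) \<in> S' \<Longrightarrow> s \<le> y \<Longrightarrow> y < t \<Longrightarrow> min (f a) (f b) \<le> x \<Longrightarrow>
             x \<le> max (f a) (f b) \<Longrightarrow> x = f b \<and> y = s"
          unfolding touches_def by blast
        have "x = b \<and> y = s" if "(x, y) \<in> S" "s \<le> y" "y < t" "min a b \<le> x" "x \<le> max a b" for x y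
        proof -
          have x: "x \<in> set P" using that sub by auto
          then have "f x = f b \<and> y = s"
            using only[of "f x" y] that less a le by (simp add: min_le_iff_disj le_max_iff_disj)
          then show ?thesis using inj x less.prems by (simp add: inj_on_eq_iff)
        qed
        then show "touches S a t b" using s less unfolding touches_def by blast
      next
        assume "touches S a t b"
        then obtain s where s: "s < t" "(b, s) \<in> S"
          and only: "\<And>x y. (x, y) \<in> S \<Longrightarrow> s \<le> y \<Longrightarrow> y < t \<Longrightarrow> min a b \<le> x \<Longrightarrow>
             x \<le> max a b \<Longrightarrow> x = b \<and> y = s"
          unfolding touches_def by blast
        have "x = f b \<and> y = s"
          if "(x, y) \<in> S'" "s \<le> y" "y < t" "min (f a) (f b) \<le> x" "x \<le> max (f a) (f b)" for x y
        proof -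
          have "x \<in> f ` set P" using that(1) sub(2) by auto
          then obtain x' where x: "x' \<in> set P" "x = f x'" by blast
          then show ?thesis
            using only[of x' y] that less a le by (simp add: min_le_iff_disj le_max_iff_disj)
        qed
        then show "touches S' (f a) t (f b)" using s less unfolding touches_def by blast
      qed
      moreover have "f b = f a \<longleftrightarrow> b = a" using inj a less.prems by (simp add: inj_on_eq_iff)
      ultimately show ?thesis
        using True greedy_output_iff[of t P b] greedy_output_iff[of t "map f P" "f b"] a
        by (simp add: S_def S'_def a_def)
    qed
  qed
  have "S' = map_prod f id ` S"
  proof (intro set_eqI iffI)
    fix z assume z: "z \<in> S'"
    then obtain b t where "z = (f b, t)" "b \<in> set P" using sub by (cases z) auto
    then show "z \<in> map_prod f id ` S" using z main by force
  qed (use main sub in auto)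
  moreover have "inj_on (map_prod f id) S"
    by (rule inj_on_subset[OF map_prod_inj_on[OF inj inj_on_id] sub(1)])
  ultimately show ?thesis
    by (simp add: greedy_def S_def S'_def card_image)
qed

text \<open>Ranks are strictly increasing in the key. Skeletons and leaf permutations can therefore
  be replaced by the original key sequences in all counts.\<close>

lemma greedy_pattern: "greedy (pattern rs) = greedy rs"
proof -
  have "strict_mono_on (set rs) (\<lambda>r. card {s \<in> set rs. s \<le> r})"
  proof (rule strict_mono_onI)
    fix r s assume "r \<in> set rs" "s \<in> set rs" "r < s"
    then have "{q \<in> set rs. q \<le> r} \<subseteq> {q \<in> set rs. q \<le> s}"
      and "s \<in> {q \<in> set rs. q \<le> s}" "s \<notin> {q \<in> set rs. q \<le> r}" by auto
    then have "{q \<in> set rs. q \<le> r} \<subset> {q \<in> set rs. q \<le> s}" by blast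
    then show "card {q \<in> set rs. q \<le> r} < card {q \<in> set rs. q \<le> s}"
      by (intro psubset_card_mono) auto
  qed
  then show ?thesis unfolding pattern_def by (rule greedy_map)
qed

lemma card_UN_set_le_sum_list: "card (\<Union>x\<in>set xs. f x) \<le> (\<Sum>x\<leftarrow>xs. card (f x))"
proof (induction xs)
  case (Cons a xs)
  have "card (\<Union>x\<in>set (a # xs). f x) \<le> card (f a) + card (\<Union>x\<in>set xs. f x)"
    using card_Un_le by simp
  then show ?case using Cons by simp
qed simp

subsection \<open>Block decomposition trees\<close>

lemma set_nodes: "set (nodes v) = insert v (\<Union>c\<in>set (children v). set (nodes c))"
  by (cases v) simp

lemma self_in_nodes [simp]: "v \<in> set (nodes v)"
  by (cases v) simp

lemma nth_in_nodes: "i < length (children v) \<Longrightarrow> children v ! i \<in> set (nodes v)"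
  unfolding set_nodes[of v] using nth_mem self_in_nodes by blast

lemma nodes_trans: "v \<in> set (nodes w) \<Longrightarrow> u \<in> set (nodes v) \<Longrightarrow> u \<in> set (nodes w)"
proof (induction w)
  case (Node a b vs)
  show ?case
  proof (cases "v = Node a b vs")
    case False
    then obtain c where "c \<in> set vs" "v \<in> set (nodes c)" using Node.prems by auto
    then show ?thesis using Node.IH Node.prems by auto
  qed (use Node.prems in simp)
qed

lemma partitions_times_less:
  assumes "partitions_times cs v" "\<And>c. c \<in> set cs \<Longrightarrow> first_time c \<le> last_time c"
    and "i < j" "j < length cs"
  shows "last_time (cs ! i) < first_time (cs ! j)"
  using assms(3,4)
proof (induction j)
  case (Suc j)
  have "first_time (cs ! Suc j) = Suc (last_time (cs ! j))"
    using assms(1) Suc.prems by (simp add: partitions_times_def)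
  moreover have "last_time (cs ! i) \<le> last_time (cs ! j)"
  proof (cases "i = j")
    case False
    then have "last_time (cs ! i) < first_time (cs ! j)" using Suc by simp
    also have "\<dots> \<le> last_time (cs ! j)" using assms(2) Suc.prems by simp
    finally show ?thesis by simp
  qed simp
  ultimately show ?case by simp
qed simp

lemma partitions_times_cover:
  assumes "partitions_times cs v" "t \<in> times v"
  obtains i where "i < length cs" "t \<in> times (cs ! i)"
proof -
  have "\<exists>i\<le>m. t \<in> times (cs ! i)" if "m < length cs" "t \<le> last_time (cs ! m)" for m
    using that
  proof (induction m)
    case 0
    then show ?case using assms by (auto simp: partitions_times_def times_def hd_conv_nth)
  next
    case (Suc m)
    show ?case
    proof (cases "t \<le> last_time (cs ! m)")
      case True
      then obtain i where "i \<le> m" "t \<in> times (cs ! i)" using Suc by auto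
      then show ?thesis by (intro exI[of _ i]) simp
    next
      case False
      then have "t \<in> times (cs ! Suc m)"
        using Suc.prems assms(1) by (auto simp: partitions_times_def times_def)
      then show ?thesis by blast
    qed
  qed
  moreover have "length cs - 1 < length cs" "t \<le> last_time (cs ! (length cs - 1))"
    using assms by (auto simp: partitions_times_def times_def last_conv_nth)
  ultimately show ?thesis using that by (meson le_less_trans)
qed

lemma filter_concat_map_single:
  assumes "i < length xs" "\<And>j. j < length xs \<Longrightarrow> j \<noteq> i \<Longrightarrow> filter p (f (xs ! j)) = []"
  shows "filter p (concat (map f xs)) = filter p (f (xs ! i))"
proof -
  have "filter p (concat (map f ys)) = []" if "\<And>y. y \<in> set ys \<Longrightarrow> filter p (f y) = []" for ys
    using that by (induction ys) auto
  moreover have "filter p (f y) = []" if "y \<in> set (take i xs) \<union> set (drop (Suc i) xs)" for y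
  proof -
    obtain j where "j < length xs" "y = xs ! j" "j \<noteq> i"
    proof (cases "y \<in> set (take i xs)")
      case True
      then obtain d where "d < i" "y = xs ! d"
        using assms(1) by (auto simp: in_set_conv_nth)
      then show ?thesis using that[of d] assms(1) by auto
    next
      case False
      then obtain d where "d < length xs - Suc i" "y = xs ! (Suc i + d)"
        using \<open>y \<in> _\<close> assms(1) by (auto simp: in_set_conv_nth)
      then show ?thesis using that[of "Suc i + d"] by auto
    qed
    then show ?thesis using assms(2) by blast
  qed
  ultimately have "filter p (concat (map f (take i xs))) = []"
    "filter p (concat (map f (drop (Suc i) xs))) = []"
    by blast+
  then show ?thesis
    by (subst id_take_nth_drop[OF assms(1)]) simp
qed

text \<open>\<open>processed_nodes\<close> has this shape. Dropping the head shifts indices by one,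
  so an entry is listed because its predecessor on the path ends at \<open>t\<close>; the last entry
  need not end there itself.\<close>

lemma in_take_takeWhile_tlD:
  assumes "u \<in> set (take (length (takeWhile p xs)) (tl xs))"
  obtains h where "Suc h < length xs" "u = xs ! Suc h" "p (xs ! h)"
proof -
  obtain h where "h < length (takeWhile p xs)" "h < length (tl xs)" "u = tl xs ! h"
    using assms by (auto simp: in_set_conv_nth)
  moreover from this have "p (xs ! h)"
    using takeWhile_nth[of h p xs] nth_mem[of h "takeWhile p xs"] set_takeWhileD[of _ p xs] by auto
  ultimately show ?thesis using that[of h] by (simp add: nth_tl)
qed

lemma in_take_takeWhile_tlI:
  assumes "Suc h < length xs" "\<And>m. m \<le> h \<Longrightarrow> p (xs ! m)"
  shows "xs ! Suc h \<in> set (take (length (takeWhile p xs)) (tl xs))"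
proof -
  have "h < length (takeWhile p xs)"
    using assms nth_length_takeWhile[of p xs] by (meson Suc_lessD le_less_trans linorder_not_less)
  then show ?thesis using assms(1)
    by (auto simp: in_set_conv_nth nth_tl intro!: exI[of _ h])
qed

section \<open>Times and keys of the nodes for a fixed permutation and tree\<close>

locale decomposed_permutation =
  fixes n :: nat and P :: "nat list" and T :: block_tree
  assumes perm: "P \<in> permutations_of_set {1..n}"
    and tree: "block_decomposition_tree P T"
begin

lemma length_P: "length P = n"
  using perm by (auto simp: permutations_of_set_def distinct_card[symmetric])

lemma inj_access: "inj_on (access P) {1..n}"
  using perm length_P
  by (auto simp: permutations_of_set_def inj_on_def access_def nth_eq_iff_index_eq)

lemma access_in: "1 \<le> t \<Longrightarrow> t \<le> n \<Longrightarrow> access P t \<in> {1..n}"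
  using perm length_P by (auto simp: permutations_of_set_def access_def)

lemma times_T: "times T = {1..n}"
  using tree length_P by (auto simp: block_decomposition_tree_def times_def)

lemma node_bounds:
  assumes "v \<in> set (nodes T)"
  shows "1 \<le> first_time v" "first_time v \<le> last_time v" "last_time v \<le> n"
  using assms tree length_P by (auto simp: block_decomposition_tree_def is_block_def)

lemma endpoints_in_times:
  assumes "v \<in> set (nodes T)"
  shows "first_time v \<in> times v" "last_time v \<in> times v"
  using node_bounds[OF assms] by (auto simp: times_def)

lemma child_in_nodes:
  assumes "v \<in> set (nodes T)" "i < length (children v)"
  shows "children v ! i \<in> set (nodes T)"
  by (rule nodes_trans[OF assms(1) nth_in_nodes[OF assms(2)]])

lemma partition:
  assumes "v \<in> set (nodes T)" "\<not> is_leaf v"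
  shows "partitions_times (children v) v"
  using assms tree by (auto simp: block_decomposition_tree_def)

lemma children_less:
  assumes "v \<in> set (nodes T)" "i < j" "j < length (children v)"
  shows "last_time (children v ! i) < first_time (children v ! j)"
proof (rule partitions_times_less[OF partition])
  show "\<not> is_leaf v" using assms by (auto simp: is_leaf_def)
  show "first_time c \<le> last_time c" if "c \<in> set (children v)" for c
    using that child_in_nodes[OF assms(1)] node_bounds by (auto simp: in_set_conv_nth)
qed (use assms in auto)

lemma child_cover:
  assumes "v \<in> set (nodes T)" "\<not> is_leaf v" "t \<in> times v"
  obtains i where "i < length (children v)" "t \<in> times (children v ! i)"
  using partitions_times_cover[OF partition[OF assms(1,2)] assms(3)] by blast

lemma child_unique:
  assumes "v \<in> set (nodes T)" "i < length (children v)" "j < length (children v)"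
    and "t \<in> times (children v ! i)" "t \<in> times (children v ! j)"
  shows "i = j"
  using children_less[OF assms(1), of i j] children_less[OF assms(1), of j i] assms
  by (cases i j rule: linorder_cases) (auto simp: times_def)

lemma child_times_subset:
  assumes "v \<in> set (nodes T)" "i < length (children v)"
  shows "times (children v ! i) \<subseteq> times v"
proof -
  let ?c = "\<lambda>i. children v ! i" and ?k = "length (children v) - 1"
  have nl: "\<not> is_leaf v" using assms by (auto simp: is_leaf_def)
  have "first_time v = first_time (?c 0)" "last_time v = last_time (?c ?k)"
    using partition[OF assms(1) nl] by (auto simp: partitions_times_def hd_conv_nth last_conv_nth)
  moreover have "0 < length (children v)" "?k < length (children v)" using assms(2) by auto
  note bounds = this[THEN child_in_nodes[OF assms(1)], THEN node_bounds(2)]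
  have "first_time (?c 0) \<le> first_time (?c i)"
    using children_less[OF assms(1), of 0 i] bounds(1) assms(2) by (cases "i = 0") auto
  moreover have "last_time (?c i) \<le> last_time (?c ?k)"
  proof (cases "i = ?k")
    case False
    then have "i < ?k" "?k < length (children v)" using assms(2) by auto
    then show ?thesis using children_less[OF assms(1), of i ?k] bounds(2) by linarith
  qed simp
  ultimately show ?thesis by (auto simp: times_def)
qed

lemma proper_descendantE:
  assumes "u \<in> set (nodes v)" "u \<noteq> v"
  obtains i where "i < length (children v)" "u \<in> set (nodes (children v ! i))"
proof -
  obtain c where "c \<in> set (children v)" "u \<in> set (nodes c)"
    using assms by (auto simp: set_nodes[of v])
  then show ?thesis using that by (auto simp: in_set_conv_nth[of c])
qed

lemma descendant_times_subset:
  "v \<in> set (nodes T) \<Longrightarrow> u \<in> set (nodes v) \<Longrightarrow> times u \<subseteq> times v"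
proof (induction v)
  case (Node a b vs)
  show ?case
  proof (cases "u = Node a b vs")
    case False
    then obtain i where i: "i < length vs" "u \<in> set (nodes (vs ! i))"
      using proper_descendantE[OF Node.prems(2)] by auto
    then have "times u \<subseteq> times (vs ! i)"
      using Node.IH[of "vs ! i"] child_in_nodes[OF Node.prems(1), of i] by auto
    then show ?thesis using child_times_subset[OF Node.prems(1), of i] i by auto
  qed simp
qed

text \<open>Induction on a common ancestor \<open>w\<close>, started at the root: if neither node
  equals \<open>w\<close>, both lie below the unique child of \<open>w\<close> that contains
  \<open>t\<close>.\<close>

lemma laminar:
  assumes "u \<in> set (nodes T)" "v \<in> set (nodes T)" "t \<in> times u" "t \<in> times v"
  shows "u \<in> set (nodes v) \<or> v \<in> set (nodes u)"
proof -
  have "w \<in> set (nodes T) \<Longrightarrow> u \<in> set (nodes w) \<Longrightarrow> v \<in> set (nodes w) \<Longrightarrow>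
      u \<in> set (nodes v) \<or> v \<in> set (nodes u)" for w
  proof (induction w)
    case (Node a b vs)
    let ?w = "Node a b vs"
    show ?case
    proof (cases "u = ?w \<or> v = ?w")
      case False
      then have "u \<noteq> ?w" "v \<noteq> ?w" by auto
      obtain i where i: "i < length vs" "u \<in> set (nodes (vs ! i))"
        using proper_descendantE[OF Node.prems(2) \<open>u \<noteq> ?w\<close>] unfolding block_tree.sel .
      obtain j where j: "j < length vs" "v \<in> set (nodes (vs ! j))"
        using proper_descendantE[OF Node.prems(3) \<open>v \<noteq> ?w\<close>] unfolding block_tree.sel .
      have nodes: "vs ! i \<in> set (nodes T)" "vs ! j \<in> set (nodes T)"
        using child_in_nodes[OF Node.prems(1)] i j by auto
      then have "t \<in> times (vs ! i)" "t \<in> times (vs ! j)"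
        using descendant_times_subset[of "vs ! i" u] descendant_times_subset[of "vs ! j" v] i j assms by auto
      then have "i = j" using child_unique[OF Node.prems(1), of i j t] i j by simp
      then show ?thesis using Node.IH[OF nth_mem[OF i(1)] nodes(1) i(2)] j by simp
    next
      case True
      then show ?thesis using Node.prems(2,3) by metis
    qed
  qed
  from this[of T] show ?thesis using assms(1,2) by simp
qed

lemma keys_eq_interval:
  assumes "v \<in> set (nodes T)"
  shows "keys P v = {Min (keys P v)..Max (keys P v)}"
proof -
  obtain c d where cd: "keys P v = {c..d}"
    using assms tree unfolding block_decomposition_tree_def is_block_def by blast
  moreover have "keys P v \<noteq> {}"
    using endpoints_in_times[OF assms] by (auto simp: keys_def)
  ultimately have "c \<le> d" by auto
  moreover from this have "Min {c..d} = c" "Max {c..d} = d"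
    by (auto intro: Min_eqI Max_eqI)
  ultimately show ?thesis using cd by simp
qed

lemma finite_keys [simp]: "finite (keys P v)"
  by (simp add: keys_def times_def)

lemma keys_nonempty: "v \<in> set (nodes T) \<Longrightarrow> keys P v \<noteq> {}"
  using endpoints_in_times(1)[of v] by (auto simp: keys_def)

lemma access_in_keys: "t \<in> times v \<Longrightarrow> access P t \<in> keys P v"
  by (simp add: keys_def)

lemma times_subset: "v \<in> set (nodes T) \<Longrightarrow> times v \<subseteq> {1..n}"
  using node_bounds[of v] by (auto simp: times_def)

lemma keys_subset: "v \<in> set (nodes T) \<Longrightarrow> keys P v \<subseteq> {1..n}"
  unfolding keys_def using times_subset[of v] access_in by (auto simp: image_subset_iff subset_iff)

text \<open>Each key is accessed only once, so membership of keys in blocks reduces to membership of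
  times; disjointness of times thus passes on to keys.\<close>

lemma access_in_keys_iff:
  assumes "v \<in> set (nodes T)" "1 \<le> t" "t \<le> n"
  shows "access P t \<in> keys P v \<longleftrightarrow> t \<in> times v"
  unfolding keys_def using inj_on_image_mem_iff[OF inj_access _ times_subset[OF assms(1)]] assms(2,3)
  by simp

lemma common_key_time:
  assumes "u \<in> set (nodes T)" "v \<in> set (nodes T)" "b \<in> keys P u" "b \<in> keys P v"
  obtains t where "t \<in> times u" "t \<in> times v" "b = access P t"
proof -
  obtain t where t: "t \<in> times u" "b = access P t" using assms by (auto simp: keys_def)
  then have "t \<in> times v" using access_in_keys_iff[OF assms(2), of t] times_subset[OF assms(1)] assms(4) by auto
  then show ?thesis using that t by blast
qed

lemma child_key_unique:
  assumes "v \<in> set (nodes T)" "i < length (children v)" "j < length (children v)"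
    and "b \<in> keys P (children v ! i)" "b \<in> keys P (children v ! j)"
  shows "i = j"
proof -
  obtain t where "t \<in> times (children v ! i)" "t \<in> times (children v ! j)"
    using common_key_time[OF child_in_nodes[OF assms(1,2)] child_in_nodes[OF assms(1,3)] assms(4,5)] .
  then show ?thesis by (rule child_unique[OF assms(1-3)])
qed

lemma keys_mono: "times u \<subseteq> times v \<Longrightarrow> keys P u \<subseteq> keys P v"
  by (auto simp: keys_def)

lemma child_key_cover:
  assumes "v \<in> set (nodes T)" "\<not> is_leaf v" "b \<in> keys P v"
  obtains i where "i < length (children v)" "b \<in> keys P (children v ! i)"
proof -
  obtain t where t: "t \<in> times v" "b = access P t" using assms by (auto simp: keys_def)
  obtain i where "i < length (children v)" "t \<in> times (children v ! i)"
    using child_cover[OF assms(1,2) t(1)] .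
  then show ?thesis using that[of i] t access_in_keys[of t] by simp
qed

text \<open>Descend from the root as long as the child containing key \<open>b\<close> and the child
  containing time \<open>t\<close> coincide. The descent stops at a leaf or where the two separate;
  every output point is charged to the place where it stops.\<close>

lemma deepest_node:
  assumes "b \<in> {1..n}" "t \<in> {1..n}"
  obtains v where "v \<in> set (nodes T)" "is_leaf v" "b \<in> keys P v" "t \<in> times v"
  | v i j where "v \<in> set (nodes T)" "\<not> is_leaf v" "i < length (children v)" "j < length (children v)"
      "i \<noteq> j" "b \<in> keys P (children v ! i)" "t \<in> times (children v ! j)"
proof -
  have "w \<in> set (nodes T) \<Longrightarrow> b \<in> keys P w \<Longrightarrow> t \<in> times w \<Longrightarrow>
     (\<exists>v\<in>set (nodes T). is_leaf v \<and> b \<in> keys P v \<and> t \<in> times v) \<or>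
     (\<exists>v\<in>set (nodes T). \<exists>i j. \<not> is_leaf v \<and> i < length (children v) \<and> j < length (children v) \<and>
        i \<noteq> j \<and> b \<in> keys P (children v ! i) \<and> t \<in> times (children v ! j))" for w
  proof (induction w)
    case (Node c d vs)
    let ?w = "Node c d vs"
    show ?case
    proof (cases "is_leaf ?w")
      case False
      obtain i where i: "i < length vs" "b \<in> keys P (vs ! i)"
        using child_key_cover[OF Node.prems(1) False Node.prems(2)] by auto
      obtain j where j: "j < length vs" "t \<in> times (vs ! j)"
        using child_cover[OF Node.prems(1) False Node.prems(3)] by auto
      show ?thesis
      proof (cases "i = j")
        case True
        then show ?thesis
          using Node.IH[of "vs ! i"] i j child_in_nodes[OF Node.prems(1), of i] by auto
      next
        case ne: False
        then show ?thesis using Node.prems(1) False i j by (intro disjI2 bexI[of _ ?w] exI[of _ i] exI[of _ j]) auto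
      qed
    qed (use Node.prems in blast)
  qed
  moreover have "b \<in> keys P T"
  proof -
    have "card (access P ` {1..n}) = n" using inj_access by (simp add: card_image)
    moreover have "access P ` {1..n} \<subseteq> {1..n}" using access_in by auto
    ultimately have "access P ` {1..n} = {1..n}" by (intro card_subset_eq) auto
    then show ?thesis using assms by (simp add: keys_def times_T)
  qed
  moreover have "t \<in> times T" using assms times_T by simp
  ultimately have "(\<exists>v\<in>set (nodes T). is_leaf v \<and> b \<in> keys P v \<and> t \<in> times v) \<or>
     (\<exists>v\<in>set (nodes T). \<exists>i j. \<not> is_leaf v \<and> i < length (children v) \<and> j < length (children v) \<and>
        i \<noteq> j \<and> b \<in> keys P (children v ! i) \<and> t \<in> times (children v ! j))"
    using self_in_nodes by blast
  then show ?thesis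
  proof (elim disjE bexE exE conjE)
  qed (rule that; assumption)+
qed

text \<open>Among the children of a node only the one containing \<open>t\<close> contributes to the
  filtered preorder, since descendants have smaller time intervals. Preorder lists a node before its
  subtrees, so what remains is a downward path ending in a leaf.\<close>

lemma path_chain:
  assumes "w \<in> set (nodes T)" "t \<in> times w"
  defines "fl \<equiv> filter (\<lambda>v. t \<in> times v) (nodes w)"
  shows "fl \<noteq> [] \<and> hd fl = w \<and> is_leaf (last fl) \<and>
    (\<forall>m. Suc m < length fl \<longrightarrow> (\<exists>j<length (children (fl ! m)). fl ! Suc m = children (fl ! m) ! j))"
  using assms(1,2) unfolding fl_def
proof (induction w)
  case (Node a b vs)
  let ?w = "Node a b vs"
  show ?case
  proof (cases "is_leaf ?w")
    case True
    then show ?thesis using Node.prems by (simp add: is_leaf_def)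
  next
    case False
    obtain i where i: "i < length vs" "t \<in> times (vs ! i)"
      using child_cover[OF Node.prems(1) False Node.prems(2)] by auto
    have "filter (\<lambda>v. t \<in> times v) (nodes (vs ! j)) = []" if "j < length vs" "j \<noteq> i" for j
    proof -
      have "t \<notin> times (vs ! j)"
        using child_unique[OF Node.prems(1), of i j] i that by auto
      then show ?thesis
        using descendant_times_subset[of "vs ! j"] child_in_nodes[OF Node.prems(1), of j] that
        by (auto simp: filter_empty_conv)
    qed
    then have eq: "filter (\<lambda>v. t \<in> times v) (nodes ?w) = ?w # filter (\<lambda>v. t \<in> times v) (nodes (vs ! i))"
      using Node.prems filter_concat_map_single[OF i(1), of "\<lambda>v. t \<in> times v" nodes] by simp
    define fl where "fl = filter (\<lambda>v. t \<in> times v) (nodes (vs ! i))"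
    have IH: "fl \<noteq> []" "hd fl = vs ! i" "is_leaf (last fl)"
      "\<And>m. Suc m < length fl \<Longrightarrow> \<exists>j<length (children (fl ! m)). fl ! Suc m = children (fl ! m) ! j"
      using Node.IH[of "vs ! i"] i child_in_nodes[OF Node.prems(1), of i] by (auto simp: fl_def)
    have "\<exists>j<length (children ((?w # fl) ! m)). (?w # fl) ! Suc m = children ((?w # fl) ! m) ! j"
      if "Suc m < length (?w # fl)" for m
    proof (cases m)
      case 0
      then show ?thesis using IH i by (auto simp: hd_conv_nth)
    next
      case (Suc m')
      then show ?thesis using IH(4)[of m'] that by simp
    qed
    then show ?thesis
      unfolding eq fl_def[symmetric] using IH(1,3) by simp
  qed
qed

text \<open>Replaces the list by a local condition. For the converse, every path node below a child
  ending at \<open>t\<close> contains \<open>t\<close> and lies inside that child, so it ends at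
  \<open>t\<close> as well and \<open>takeWhile\<close> does not stop before reaching that
  child.\<close>

lemma processed_nodes_iff:
  assumes "t \<in> {1..n}"
  shows "u \<in> set (processed_nodes T t) \<longleftrightarrow> u \<in> set (nodes T) \<and>
    (\<exists>j<length (children u). last_time (children u ! j) = t)"
proof -
  define fl where "fl = filter (\<lambda>v. t \<in> times v) (nodes T)"
  have fl: "fl \<noteq> []" "is_leaf (last fl)"
    and chain: "\<And>m. Suc m < length fl \<Longrightarrow> \<exists>j<length (children (fl ! m)). fl ! Suc m = children (fl ! m) ! j"
    using path_chain[of T t] assms times_T by (auto simp: fl_def)
  have set_fl: "x \<in> set fl \<longleftrightarrow> x \<in> set (nodes T) \<and> t \<in> times x" for x by (auto simp: fl_def)
  have proc: "set (processed_nodes T t) = set (take (length (takeWhile (\<lambda>v. last_time v = t) (rev fl))) (tl (rev fl)))"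
    by (simp add: processed_nodes_def leaf_to_root_path_def fl_def Let_def)
  show ?thesis
  proof
    assume "u \<in> set (processed_nodes T t)"
    then obtain h where h: "Suc h < length (rev fl)" "u = rev fl ! Suc h" "last_time (rev fl ! h) = t"
      unfolding proc by (rule in_take_takeWhile_tlD)
    define m where "m = length fl - Suc (Suc h)"
    have "rev fl ! Suc h = fl ! m" "rev fl ! h = fl ! Suc m" "Suc m < length fl"
      using h by (auto simp: rev_nth m_def Suc_diff_Suc)
    then show "u \<in> set (nodes T) \<and> (\<exists>j<length (children u). last_time (children u ! j) = t)"
      using chain[of m] h set_fl[of u] by auto
  next
    assume "u \<in> set (nodes T) \<and> (\<exists>j<length (children u). last_time (children u ! j) = t)"
    then obtain j where u: "u \<in> set (nodes T)" and j: "j < length (children u)" "last_time (children u ! j) = t"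
      by blast
    note c = child_in_nodes[OF u j(1)]
    have tj: "t \<in> times (children u ! j)" using endpoints_in_times[OF c] j by simp
    then have "u \<in> set fl" using set_fl u child_times_subset[OF u j(1)] by blast
    then obtain m where m: "m < length fl" "u = fl ! m" by (auto simp: in_set_conv_nth)
    have "\<not> is_leaf u" using j by (auto simp: is_leaf_def)
    then have Sm: "Suc m < length fl"
      using m fl by (metis Suc_lessI diff_Suc_1 last_conv_nth)
    then obtain j' where j': "j' < length (children u)" "fl ! Suc m = children u ! j'"
      using chain m by blast
    then have "t \<in> times (children u ! j')" using set_fl nth_mem[OF Sm] by auto
    then have "j' = j" using child_unique[OF u j'(1) j(1)] tj by simp
    have desc: "fl ! (Suc m + d) \<in> set (nodes (children u ! j))" if "Suc m + d < length fl" for d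
      using that
    proof (induction d)
      case 0
      then show ?case using j' \<open>j' = j\<close> by simp
    next
      case (Suc d)
      obtain i where "i < length (children (fl ! (Suc m + d)))"
        "fl ! (Suc m + Suc d) = children (fl ! (Suc m + d)) ! i"
        using chain[of "Suc m + d"] Suc.prems by auto
      then have "fl ! (Suc m + Suc d) \<in> set (nodes (fl ! (Suc m + d)))"
        using nth_in_nodes by metis
      then show ?case using Suc nodes_trans by auto
    qed
    define h where "h = length fl - Suc (Suc m)"
    have h: "Suc h < length (rev fl)" "rev fl ! Suc h = u"
      using Sm m by (auto simp: h_def rev_nth Suc_diff_Suc)
    have "last_time (rev fl ! h') = t" if "h' \<le> h" for h'
    proof -
      define x where "x = rev fl ! h'"
      \<comment> \<open>Positions in the reversed path up to \<open>h\<close> are exactly those of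
        the nodes strictly below \<open>u\<close> in \<open>fl\<close>, to which \<open>desc\<close>
        applies.\<close>
      have "length fl - Suc h' = Suc m + (h - h')" using that Sm by (auto simp: h_def)
      then have "x = fl ! (Suc m + (h - h'))" "Suc m + (h - h') < length fl"
        using that Sm h(1) by (auto simp: x_def rev_nth simp del: add_Suc) 
      then have "x \<in> set (nodes (children u ! j))" "x \<in> set fl"
        using desc by auto
      then have "times x \<subseteq> times (children u ! j)" "t \<in> times x" "x \<in> set (nodes T)"
        using descendant_times_subset[OF c] set_fl by auto
      then show ?thesis using j endpoints_in_times(2)[of x] unfolding x_def times_def
        by fastforce
    qed
    then show "u \<in> set (processed_nodes T t)"
      using in_take_takeWhile_tlI[OF h(1), of "\<lambda>v. last_time v = t"] unfolding proc h(2) by blast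
  qed
qed

end

subsection \<open>The output of RGreedy\<close>

lemma topwing_subset: "topwing S R \<subseteq> S \<inter> R"
  unfolding topwing_def by (rule Collect_subset)

lemma add_topwings_mono: "S \<subseteq> add_topwings P t v S"
  by (auto simp: add_topwings_def Let_def)

lemma add_topwings_time: "(b, s) \<in> add_topwings P t v S \<Longrightarrow> (b, s) \<notin> S \<Longrightarrow> s = t"
  by (auto simp: add_topwings_def Let_def)

lemma fold_add_topwings_mono: "S \<subseteq> fold (add_topwings P t) us S"
proof (induction us arbitrary: S)
  case (Cons u us)
  show ?case using add_topwings_mono[of S P t u] Cons[of "add_topwings P t u S"] by simp
qed simp

text \<open>The node that creates the point sees some intermediate set \<open>S\<close>. Its bounds
  from below and above are all that later arguments need.\<close>

lemma fold_add_topwings_source: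
  assumes "(b, s) \<in> fold (add_topwings P t) us S0" "(b, s) \<notin> S0"
  shows "\<exists>u\<in>set us. \<exists>S. S0 \<subseteq> S \<and> S \<subseteq> fold (add_topwings P t) us S0 \<and>
           (b, s) \<notin> S \<and> (b, s) \<in> add_topwings P t u S"
  using assms
proof (induction us arbitrary: S0)
  case (Cons u us)
  let ?S1 = "add_topwings P t u S0"
  have mono: "S0 \<subseteq> ?S1" "?S1 \<subseteq> fold (add_topwings P t) us ?S1"
    by (rule add_topwings_mono fold_add_topwings_mono)+
  show ?case
  proof (cases "(b, s) \<in> ?S1")
    case True
    then show ?thesis using mono Cons.prems
      by (intro bexI[of _ u] exI[of _ S0]) auto
  next
    case False
    then obtain u' S where "u' \<in> set us" "?S1 \<subseteq> S" "S \<subseteq> fold (add_topwings P t) us ?S1"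
      "(b, s) \<notin> S" "(b, s) \<in> add_topwings P t u' S"
      using Cons.IH[of ?S1] Cons.prems by auto
    then show ?thesis using mono
      by (intro bexI[of _ u'] exI[of _ S]) auto
  qed
qed simp

text \<open>The counterpart for a prescribed node: its wings are computed on some set that extends
  the initial one, and they survive to the end.\<close>

lemma fold_add_topwings_complete:
  assumes "u \<in> set us"
  obtains S where "S0 \<subseteq> S" "add_topwings P t u S \<subseteq> fold (add_topwings P t) us S0"
proof -
  obtain xs ys where us: "us = xs @ u # ys" using assms by (meson split_list)
  show ?thesis
  proof
    show "S0 \<subseteq> fold (add_topwings P t) xs S0" by (rule fold_add_topwings_mono)
    show "add_topwings P t u (fold (add_topwings P t) xs S0) \<subseteq> fold (add_topwings P t) us S0"
      unfolding us by (simp add: fold_add_topwings_mono)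
  qed
qed

lemma rgreedy_output_mono: "rgreedy_output P T t \<subseteq> rgreedy_output P T (Suc t)"
  using fold_add_topwings_mono by (force simp: Let_def)

lemma rgreedy_output_new_time:
  assumes "(b, s) \<in> rgreedy_output P T (Suc t)" "(b, s) \<notin> rgreedy_output P T t"
  shows "s = Suc t"
proof -
  let ?S = "rgreedy_output P T t"
  let ?S0 = "?S \<union> greedy_points ?S (access P (Suc t)) (Suc t)"
  show ?thesis
  proof (cases "(b, s) \<in> ?S0")
    case True
    then show ?thesis using assms(2) by (auto simp: greedy_points_iff)
  next
    case False
    then obtain u S where "(b, s) \<notin> S" "(b, s) \<in> add_topwings P (Suc t) u S"
      using fold_add_topwings_source[of b s P "Suc t" "processed_nodes T (Suc t)" ?S0] assms(1)
      by (auto simp: Let_def)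
    then show ?thesis using add_topwings_time by blast
  qed
qed

lemma rgreedy_output_time: "(b, s) \<in> rgreedy_output P T t \<Longrightarrow> 1 \<le> s \<and> s \<le> t"
proof (induction t)
  case (Suc t)
  then show ?case
    using rgreedy_output_new_time[of b s P T t]
    by (cases "(b, s) \<in> rgreedy_output P T t") (auto simp del: rgreedy_output.simps(2))
qed simp

lemma rgreedy_output_restrict:
  "s \<le> t \<Longrightarrow> t \<le> m \<Longrightarrow> (b, s) \<in> rgreedy_output P T m \<longleftrightarrow> (b, s) \<in> rgreedy_output P T t"
proof (induction m)
  case (Suc m)
  show ?case
  proof (cases "t = Suc m")
    case False
    then have "(b, s) \<in> rgreedy_output P T (Suc m) \<longleftrightarrow> (b, s) \<in> rgreedy_output P T m"
      using rgreedy_output_new_time[of b s P T m] rgreedy_output_mono[of P T m] Suc.prems by auto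
    then show ?thesis using Suc False by (simp del: rgreedy_output.simps(2))
  qed simp
qed simp

context decomposed_permutation
begin

section \<open>The final output and the origin of its points\<close>

definition out :: "point set" where
  "out = rgreedy_output P T n"

text \<open>The points of the Greedy phase of RGreedy at time \<open>t\<close>, before any top wing.
  Using the final output is harmless because \<open>touches\<close> ignores times from
  \<open>t\<close> on.\<close>

definition greedy_at :: "nat \<Rightarrow> nat \<Rightarrow> bool" where
  "greedy_at b t \<longleftrightarrow> b = access P t \<or> touches out (access P t) t b"

lemma out_time: "(b, t) \<in> out \<Longrightarrow> t \<in> {1..n}"
  using rgreedy_output_time by (auto simp: out_def)

text \<open>All key intervals are treated alike, so sorting the children does not affect the union.
  From here on both indices of a region number the children in time order; in particular
  \<open>i = j\<close> is the diagonal region, the block of the child itself.\<close>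

lemma add_topwings_eq:
  assumes "u \<in> set (nodes T)" "j < length (children u)" "t \<in> times (children u ! j)"
  shows "add_topwings P t u S = S \<union> (\<Union>i<length (children u).
     (\<lambda>q. (fst q, t)) ` topwing S (keys P (children u ! i) \<times> times (children u ! j)))"
proof -
  let ?cs = "children u" and ?f = "\<lambda>c. Min (keys P c)"
  have the: "(THE j. j < length ?cs \<and> (access P t, t) \<in> block P (?cs ! j)) = j"
  proof (rule the_equality)
    show "j < length ?cs \<and> (access P t, t) \<in> block P (?cs ! j)"
      using assms by (simp add: block_def access_in_keys)
    show "j' = j" if "j' < length ?cs \<and> (access P t, t) \<in> block P (?cs ! j')" for j'
      using child_unique[OF assms(1), of j' j t] assms that by (simp add: block_def)
  qed
  have image: "(\<Union>i<length xs. F (xs ! i)) = (\<Union>c\<in>set xs. F c)" for xs :: "block_tree list" and F :: "block_tree \<Rightarrow> point set"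
    unfolding set_conv_nth by auto
  have "(\<Union>i<length ?cs. F (sort_key ?f ?cs ! i)) = (\<Union>i<length ?cs. F (?cs ! i))" for F :: "block_tree \<Rightarrow> point set"
    using image[of F ?cs] image[of F "sort_key ?f ?cs"] by simp
  from this[of "\<lambda>c. (\<lambda>q. (fst q, t)) ` topwing S (keys P c \<times> times (?cs ! j))"]
  show ?thesis unfolding add_topwings_def Let_def the region_def key_interval_def by simp
qed

text \<open>\<open>S0\<close> is the output at time \<open>t\<close> between the Greedy phase and
  the top wings.\<close>

lemma out_step:
  assumes "t \<in> {1..n}"
  obtains S0 where "\<forall>b s. (b, s) \<in> S0 \<longleftrightarrow> (b, s) \<in> out \<and> s < t \<or> s = t \<and> greedy_at b t"
    and "\<forall>b s. s \<le> t \<longrightarrow> ((b, s) \<in> out \<longleftrightarrow> (b, s) \<in> fold (add_topwings P t) (processed_nodes T t) S0)"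
    and "fold (add_topwings P t) (processed_nodes T t) S0 \<subseteq> out"
proof -
  obtain m where m: "t = Suc m" using assms by (cases t) auto
  define S where "S = rgreedy_output P T m"
  define S0 where "S0 = S \<union> greedy_points S (access P t) t"
  have fold_eq: "fold (add_topwings P t) (processed_nodes T t) S0 = rgreedy_output P T t"
    unfolding S0_def S_def m by (simp add: Let_def)
  have S: "(b, s) \<in> S \<longleftrightarrow> (b, s) \<in> out \<and> s < t" for b s
  proof (cases "s < t")
    case True
    then show ?thesis
      using rgreedy_output_restrict[of s m n b P T] assms unfolding S_def out_def m by simp
  next
    case False
    then show ?thesis
      using rgreedy_output_time[of b s P T m] unfolding S_def m by auto
  qed
  have "touches S (access P t) t b \<longleftrightarrow> touches out (access P t) t b" for b
    by (rule touches_cong) (simp add: S)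
  then have "(b, s) \<in> S0 \<longleftrightarrow> (b, s) \<in> out \<and> s < t \<or> s = t \<and> greedy_at b t" for b s
    unfolding S0_def greedy_at_def using S[of b s] assms greedy_points_iff[of t b s S "access P t"] by auto
  moreover have eq: "(b, s) \<in> out \<longleftrightarrow> (b, s) \<in> rgreedy_output P T t" if "s \<le> t" for b s
    using rgreedy_output_restrict[of s t n b P T] assms that unfolding out_def by simp
  moreover have "rgreedy_output P T t \<subseteq> out"
  proof (rule subrelI)
    fix b s assume "(b, s) \<in> rgreedy_output P T t"
    then show "(b, s) \<in> out" using eq[of s b] rgreedy_output_time[of b s P T t] by simp
  qed
  ultimately show ?thesis using that[of S0] unfolding fold_eq by simp
qed

lemma greedy_at_out:
  assumes "t \<in> {1..n}" "greedy_at b t"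
  shows "(b, t) \<in> out"
proof -
  obtain S0 where "\<forall>b s. (b, s) \<in> S0 \<longleftrightarrow> (b, s) \<in> out \<and> s < t \<or> s = t \<and> greedy_at b t"
    and "\<forall>b s. s \<le> t \<longrightarrow> ((b, s) \<in> out \<longleftrightarrow> (b, s) \<in> fold (add_topwings P t) (processed_nodes T t) S0)"
    and "fold (add_topwings P t) (processed_nodes T t) S0 \<subseteq> out"
    using out_step[OF assms(1)] .
  moreover from this have "(b, t) \<in> S0" using assms(2) by simp
  ultimately show ?thesis using fold_add_topwings_mono[of S0 P t "processed_nodes T t"] by blast
qed

lemma access_out: "t \<in> {1..n} \<Longrightarrow> (access P t, t) \<in> out"
  by (rule greedy_at_out) (auto simp: greedy_at_def)

text \<open>A point outside the Greedy phase comes from a top wing, so its column already holds an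
  older point of the same region. This is what lets inductions on time go through.\<close>

lemma out_source:
  assumes "(b, t) \<in> out" "\<not> greedy_at b t"
  obtains u i j s S where "u \<in> set (nodes T)" "i < length (children u)" "j < length (children u)"
    "last_time (children u ! j) = t" "b \<in> keys P (children u ! i)" "s \<in> times (children u ! j)" "s < t"
    "(b, s) \<in> out" "(b, s) \<in> topwing S (keys P (children u ! i) \<times> times (children u ! j))"
    "\<forall>x y. (x, y) \<in> out \<longrightarrow> y < t \<longrightarrow> (x, y) \<in> S"
proof -
  have t: "t \<in> {1..n}" using out_time assms by blast
  obtain S0 where S0: "\<forall>b s. (b, s) \<in> S0 \<longleftrightarrow> (b, s) \<in> out \<and> s < t \<or> s = t \<and> greedy_at b t"
    and out: "\<forall>b s. s \<le> t \<longrightarrow> ((b, s) \<in> out \<longleftrightarrow> (b, s) \<in> fold (add_topwings P t) (processed_nodes T t) S0)"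
    and sub: "fold (add_topwings P t) (processed_nodes T t) S0 \<subseteq> out"
    using out_step[OF t] .
  have "(b, t) \<in> fold (add_topwings P t) (processed_nodes T t) S0" "(b, t) \<notin> S0"
    using assms out[rule_format, of t b] S0[rule_format, of b t] by blast+
  from fold_add_topwings_source[OF this]
  obtain u S where u: "u \<in> set (processed_nodes T t)"
    and S: "S0 \<subseteq> S" "S \<subseteq> fold (add_topwings P t) (processed_nodes T t) S0"
    and bt: "(b, t) \<notin> S" "(b, t) \<in> add_topwings P t u S"
    by blast
  have S_out: "S \<subseteq> out" using S(2) sub by (rule subset_trans)
  obtain j where j: "u \<in> set (nodes T)" "j < length (children u)" "last_time (children u ! j) = t"
    using u unfolding processed_nodes_iff[OF t] by blast
  have "t \<in> times (children u ! j)" using endpoints_in_times(2)[OF child_in_nodes[OF j(1,2)]] j(3) by simp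
  from bt(2)[unfolded add_topwings_eq[OF j(1,2) this]] bt(1)
  obtain i q where i: "i < length (children u)"
    and q: "q \<in> topwing S (keys P (children u ! i) \<times> times (children u ! j))" "b = fst q"
    by blast
  obtain s where s: "q = (b, s)" using q by (cases q) auto
  have mem: "(b, s) \<in> S" "b \<in> keys P (children u ! i)" "s \<in> times (children u ! j)"
    using q(1) topwing_subset unfolding s by blast+
  \<comment> \<open>Equality is excluded because \<open>(b, t)\<close> is not yet in
    \<open>S\<close>, whereas \<open>(b, s)\<close> is.\<close>
  then have "s < t" using bt(1) j(3) unfolding times_def by (metis atLeastAtMost_iff le_neq_implies_less)
  moreover have "(x, y) \<in> S" if "(x, y) \<in> out" "y < t" for x y
    by (rule subsetD[OF S(1)]) (use that S0[rule_format, of x y] in blast)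
  moreover have "(b, s) \<in> out" using mem(1) S_out by blast
  ultimately show ?thesis
    using that[OF j(1) i j(2,3) mem(2,3), of S] q(1)[unfolded s] by blast
qed

text \<open>\<open>S\<close> is the output at the moment node \<open>u\<close> is processed. At time
  \<open>t\<close> itself only the Greedy points are guaranteed to be in it, as wings of other nodes
  may come later.\<close>

lemma out_topwing:
  assumes "u \<in> set (nodes T)" "i < length (children u)" "j < length (children u)"
  defines "t \<equiv> last_time (children u ! j)"
  obtains S where "S \<subseteq> out" "\<forall>b s. (b, s) \<in> out \<longrightarrow> s < t \<longrightarrow> (b, s) \<in> S" "\<forall>b. greedy_at b t \<longrightarrow> (b, t) \<in> S"
    "\<forall>b s. (b, s) \<in> topwing S (keys P (children u ! i) \<times> times (children u ! j)) \<longrightarrow> (b, t) \<in> out"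
proof -
  have tj: "t \<in> times (children u ! j)"
    using endpoints_in_times(2)[OF child_in_nodes[OF assms(1,3)]] by (simp add: t_def)
  then have t: "t \<in> {1..n}" using times_subset[OF child_in_nodes[OF assms(1,3)]] by blast
  obtain S0 where S0: "\<forall>b s. (b, s) \<in> S0 \<longleftrightarrow> (b, s) \<in> out \<and> s < t \<or> s = t \<and> greedy_at b t"
    and "\<forall>b s. s \<le> t \<longrightarrow> ((b, s) \<in> out \<longleftrightarrow> (b, s) \<in> fold (add_topwings P t) (processed_nodes T t) S0)"
    and sub: "fold (add_topwings P t) (processed_nodes T t) S0 \<subseteq> out"
    using out_step[OF t] .
  have "u \<in> set (processed_nodes T t)" using processed_nodes_iff[OF t] assms by auto
  then obtain S where S: "S0 \<subseteq> S" "add_topwings P t u S \<subseteq> fold (add_topwings P t) (processed_nodes T t) S0"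
    by (rule fold_add_topwings_complete)
  have "(b, t) \<in> out" if "(b, s) \<in> topwing S (keys P (children u ! i) \<times> times (children u ! j))" for b s
  proof -
    have "(b, t) \<in> add_topwings P t u S"
      unfolding add_topwings_eq[OF assms(1,3) tj] using that assms(2) by force
    then show ?thesis using S(2) sub by blast
  qed
  moreover have "S \<subseteq> out" using add_topwings_mono S(2) sub by blast
  ultimately show ?thesis using that[of S] S0 S(1) by blast
qed

text \<open>There is no initial tree: both Greedy and the top wings only extend columns that already
  hold a point, so the first point of a column is its access point.\<close>

lemma out_key_accessed:
  "(b, t) \<in> out \<Longrightarrow> \<exists>s. 1 \<le> s \<and> s \<le> t \<and> b = access P s"
proof (induction t rule: less_induct)
  case (less t)
  have earlier: "\<exists>s. 1 \<le> s \<and> s \<le> t \<and> b = access P s" if s: "s < t" "(b, s) \<in> out" for s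
  proof -
    obtain r where "1 \<le> r" "r \<le> s" "b = access P r" using less.IH[OF s] by blast
    then show ?thesis using s(1) by (intro exI[of _ r]) simp
  qed
  show ?case
  proof (cases "greedy_at b t")
    case True
    then show ?thesis
      using earlier out_time[OF less.prems] by (auto simp: greedy_at_def touches_def)
  next
    case False
    obtain s where "s < t" "(b, s) \<in> out" using out_source[OF less.prems False] by metis
    then show ?thesis by (rule earlier)
  qed
qed

lemma out_key_first_time:
  assumes "(b, t) \<in> out" "w \<in> set (nodes T)" "b \<in> keys P w"
  shows "first_time w \<le> t"
proof -
  obtain s where s: "1 \<le> s" "s \<le> t" "b = access P s" using out_key_accessed[OF assms(1)] by blast
  then have "s \<in> times w" using access_in_keys_iff[OF assms(2), of s] out_time[OF assms(1)] assms(3) by auto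
  then show ?thesis using s by (simp add: times_def)
qed

lemma out_subset: "out \<subseteq> {1..n} \<times> {1..n}"
proof (rule subrelI)
  fix b t assume bt: "(b, t) \<in> out"
  then obtain s where "1 \<le> s" "s \<le> t" "b = access P s" using out_key_accessed by blast
  then show "(b, t) \<in> {1..n} \<times> {1..n}" using access_in[of s] out_time[OF bt] by auto
qed

lemma finite_out: "finite out"
  using out_subset by (rule finite_subset) simp

text \<open>In the topmost occupied row of the region, the leftmost point sees nothing towards the
  upper left corner and hence belongs to the top wing. The rectangle stays inside the region because
  its keys form an interval. The last hypothesis ensures that the given point is present when the
  wing is computed.\<close>

lemma topwing_nonempty:
  assumes "u \<in> set (nodes T)" "i < length (children u)" "j < length (children u)"
    and "(b, s) \<in> out" "b \<in> keys P (children u ! i)" "s \<in> times (children u ! j)"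
    and "s < last_time (children u ! j) \<or> greedy_at b s"
  obtains b' where "b' \<in> keys P (children u ! i)" "(b', last_time (children u ! j)) \<in> out"
proof -
  let ?c = "children u ! i" and ?w = "children u ! j"
  let ?t = "last_time ?w"
  let ?R = "keys P ?c \<times> times ?w"
  obtain S where S: "S \<subseteq> out" "\<forall>b s. (b, s) \<in> out \<longrightarrow> s < ?t \<longrightarrow> (b, s) \<in> S"
    "\<forall>b. greedy_at b ?t \<longrightarrow> (b, ?t) \<in> S"
    and wing: "\<forall>b s. (b, s) \<in> topwing S ?R \<longrightarrow> (b, ?t) \<in> out"
    using out_topwing[OF assms(1-3)] .
  have nodes: "?c \<in> set (nodes T)" "?w \<in> set (nodes T)" using child_in_nodes[OF assms(1)] assms(2,3) by auto
  have t: "?t \<in> times ?w" using endpoints_in_times(2)[OF nodes(2)] .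
  define y where "y = Max (snd ` (S \<inter> ?R))"
  define X where "X = {x. (x, y) \<in> S \<inter> ?R}"
  have fin: "finite (S \<inter> ?R)" using S(1) finite_out finite_subset by blast
  have "s = ?t \<or> s < ?t" using assms(6) by (auto simp: times_def)
  then have "(b, s) \<in> S \<inter> ?R" using S assms(4-7) by blast
  then have "y \<in> snd ` (S \<inter> ?R)" unfolding y_def using fin by (intro Max_in) auto
  then have "X \<noteq> {}" unfolding X_def by force
  moreover have "finite X" unfolding X_def
    using finite_subset[of X "fst ` (S \<inter> ?R)"] fin by (force simp: X_def)
  ultimately have X: "Min X \<in> X" "\<And>x. x \<in> X \<Longrightarrow> Min X \<le> x" by auto
  have y_max: "y' \<le> y" if "(x', y') \<in> S \<inter> ?R" for x' y'
    unfolding y_def using fin that by (intro Max_ge) (auto simp: image_iff intro!: bexI[of _ "(x', y')"])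
  have tl: "topleft ?R = (Min (keys P ?c), ?t)"
  proof -
    have "Max (times ?w) = ?t" using t by (intro Max_eqI) (auto simp: times_def)
    then show ?thesis using keys_nonempty[OF nodes(1)] t unfolding topleft_def by auto
  qed
  have q: "(Min X, y) \<in> S \<inter> ?R" using X(1) unfolding X_def by blast
  have "S \<inter> rect (Min X, y) (topleft ?R) \<subseteq> {(Min X, y)}"
  proof
    fix z assume z: "z \<in> S \<inter> rect (Min X, y) (topleft ?R)"
    obtain x' y' where z': "z = (x', y')" by (cases z)
    have "Min (keys P ?c) \<le> Min X" using q by auto
    moreover have "y \<le> ?t" using q by (auto simp: times_def)
    ultimately have xy: "Min (keys P ?c) \<le> x'" "x' \<le> Min X" "y \<le> y'" "y' \<le> ?t"
      using z unfolding tl z' by (auto simp: rect_def)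
    have "Min X \<le> Max (keys P ?c)" using q by auto
    then have "x' \<in> {Min (keys P ?c)..Max (keys P ?c)}" using xy by simp
    then have "x' \<in> keys P ?c" using keys_eq_interval[OF nodes(1)] by blast
    moreover have "y' \<in> times ?w" using xy q by (auto simp: times_def)
    ultimately have zR: "(x', y') \<in> S \<inter> ?R" using z z' by blast
    then have "y' = y" using y_max xy by fastforce
    then have "x' \<in> X" using zR unfolding X_def by blast
    then have "x' = Min X" using X(2)[of x'] xy by simp
    then show "z \<in> {(Min X, y)}" using z' \<open>y' = y\<close> by simp
  qed
  moreover have "\<forall>z\<in>S \<inter> ?R. fst z = fst (Min X, y) \<longrightarrow> snd z \<le> snd (Min X, y)"
    using y_max by auto
  ultimately have "(Min X, y) \<in> topwing S ?R"
    unfolding topwing_def using q by blast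
  then show ?thesis using that[of "Min X"] wing q by blast
qed

text \<open>The column holds its own access point inside the block, and the clause for outermost
  columns puts its topmost point into the top wing of the diagonal region.\<close>

lemma extreme_column_end:
  assumes "u \<in> set (nodes T)" "j < length (children u)"
    and "x = Min (keys P (children u ! j)) \<or> x = Max (keys P (children u ! j))"
  shows "(x, last_time (children u ! j)) \<in> out"
proof -
  let ?w = "children u ! j"
  let ?t = "last_time ?w" and ?R = "keys P ?w \<times> times ?w"
  have w: "?w \<in> set (nodes T)" using child_in_nodes[OF assms(1,2)] .
  have x: "x \<in> keys P ?w" using assms(3) keys_nonempty[OF w] Min_in[OF finite_keys] Max_in[OF finite_keys] by metis
  obtain S where S: "S \<subseteq> out" "\<forall>b s. (b, s) \<in> out \<longrightarrow> s < ?t \<longrightarrow> (b, s) \<in> S"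
    "\<forall>b. greedy_at b ?t \<longrightarrow> (b, ?t) \<in> S"
    and wing: "\<forall>b s. (b, s) \<in> topwing S ?R \<longrightarrow> (b, ?t) \<in> out"
    using out_topwing[OF assms(1,2,2)] .
  define Y where "Y = {y \<in> times ?w. (x, y) \<in> S}"
  obtain s where s: "s \<in> times ?w" "x = access P s" using x by (auto simp: keys_def)
  then have "(x, s) \<in> out" using access_out[of s] times_subset[OF w] by blast
  moreover have "s = ?t \<or> s < ?t" using s by (auto simp: times_def)
  ultimately have "(x, s) \<in> S" using S s by (auto simp: greedy_at_def)
  then have "s \<in> Y" using s by (simp add: Y_def)
  then have "Y \<noteq> {}" by blast
  have "finite Y" by (simp add: Y_def times_def)
  then have Y: "Max Y \<in> Y" "\<And>y. y \<in> Y \<Longrightarrow> y \<le> Max Y" using Max_in[OF _ \<open>Y \<noteq> {}\<close>] by auto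
  have "fst (topleft ?R) = Min (keys P ?w)" "fst (topright ?R) = Max (keys P ?w)"
    using endpoints_in_times(1)[OF w] by (auto simp: topleft_def topright_def)
  then have "(x, Max Y) \<in> topwing S ?R"
    unfolding topwing_def using Y x assms(3) by (auto simp: Y_def)
  then show ?thesis using wing by blast
qed

end

subsection \<open>Columns that can still be touched\<close>

text \<open>Each corner rectangle contains one of the two flanking points, and strict flanking rules
  out the clause for outermost columns.\<close>

lemma topwing_blocked:
  assumes "(b, s) \<in> topwing S R" "finite R"
    and "(l, y) \<in> S \<inter> R" "(r, z) \<in> S \<inter> R" "l < b" "b < r" "s \<le> y" "s \<le> z"
  shows False
proof -
  have "Min (fst ` R) \<le> l" "r \<le> Max (fst ` R)" "y \<le> Max (snd ` R)" "z \<le> Max (snd ` R)"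
    using assms(2-4) by (force intro: Min_le Max_ge)+
  then have "(l, y) \<in> S \<inter> rect (b, s) (topleft R)" "(r, z) \<in> S \<inter> rect (b, s) (topright R)"
    "b \<noteq> fst (topleft R)" "b \<noteq> fst (topright R)"
    using assms(3-8) by (auto simp: rect_def topleft_def topright_def)
  moreover have "S \<inter> rect (b, s) (topleft R) \<subseteq> {(b, s)} \<or> S \<inter> rect (b, s) (topright R) \<subseteq> {(b, s)} \<or>
      b = fst (topleft R) \<or> b = fst (topright R)"
    using assms(1) unfolding topwing_def by simp
  ultimately have "(l, y) = (b, s) \<or> (r, z) = (b, s)" by blast
  then show False using assms(5,6) by simp
qed

context decomposed_permutation
begin

lemma keys_between:
  assumes "v \<in> set (nodes T)" "x \<in> keys P v" "z \<in> keys P v" "x \<le> y" "y \<le> z"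
  shows "y \<in> keys P v"
proof -
  have "Min (keys P v) \<le> x" "z \<le> Max (keys P v)" using assms(2,3) by auto
  then have "y \<in> {Min (keys P v)..Max (keys P v)}" using assms(4,5) by auto
  then show ?thesis using keys_eq_interval[OF assms(1)] by blast
qed

text \<open>Consider a first point after \<open>c\<close> has ended. Accesses then lie outside the
  keys of \<open>c\<close>, so Greedy is stopped by whichever raised outer column lies in between. A
  top wing reaching the column would belong to a region that contains the whole block
  \<open>c\<close>, where both raised columns flank the point.\<close>

lemma middle_column_inactive:
  assumes "v \<in> set (nodes T)" "i < length (children v)"
  defines "c \<equiv> children v ! i"
  assumes "b \<in> keys P c" "b \<noteq> Min (keys P c)" "b \<noteq> Max (keys P c)"
  shows "(b, t) \<in> out \<Longrightarrow> t \<le> last_time c"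
proof (induction t rule: less_induct)
  case (less t)
  let ?l = "Min (keys P c)" and ?r = "Max (keys P c)"
  have c: "c \<in> set (nodes T)" unfolding c_def using child_in_nodes[OF assms(1,2)] .
  have "?l \<le> b" "b \<le> ?r" using assms(4) by auto
  then have lr: "?l < b" "b < ?r" using assms(5,6) by linarith+
  have lr_keys: "?l \<in> keys P c" "?r \<in> keys P c"
    using Min_in[OF finite_keys keys_nonempty[OF c]] Max_in[OF finite_keys keys_nonempty[OF c]] .
  have top: "(?l, last_time c) \<in> out" "(?r, last_time c) \<in> out"
    unfolding c_def using extreme_column_end[OF assms(1,2)] by blast+
  show ?case
  proof (rule ccontr)
    assume "\<not> t \<le> last_time c"
    then have late: "last_time c < t" by simp
    have t: "t \<in> {1..n}" using out_time[OF less.prems] .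
    have "t \<notin> times c" using late by (simp add: times_def)
    then have a: "access P t \<notin> keys P c" using access_in_keys_iff[OF c, of t] t by simp
    show False
    proof (cases "greedy_at b t")
      case True
      then have "touches out (access P t) t b" using a assms(4) by (auto simp: greedy_at_def)
      then obtain s where s: "s < t" "(b, s) \<in> out"
        and only: "\<And>x y. (x, y) \<in> out \<Longrightarrow> s \<le> y \<Longrightarrow> y < t \<Longrightarrow> min (access P t) b \<le> x \<Longrightarrow>
          x \<le> max (access P t) b \<Longrightarrow> x = b \<and> y = s"
        unfolding touches_def by blast
      have "s \<le> last_time c" using less.IH[OF s] .
      moreover have "access P t < ?l \<or> ?r < access P t"
        using keys_between[OF c lr_keys, of "access P t"] a by force
      ultimately show False
        using only[OF top(1)] only[OF top(2)] late lr by auto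
    next
      case False
      obtain u m j s S where u: "u \<in> set (nodes T)" "m < length (children u)" "j < length (children u)"
        and tj: "last_time (children u ! j) = t" and bm: "b \<in> keys P (children u ! m)"
        and sj: "s \<in> times (children u ! j)" and s: "s < t" "(b, s) \<in> out"
        and wing: "(b, s) \<in> topwing S (keys P (children u ! m) \<times> times (children u ! j))"
        and S: "\<forall>x y. (x, y) \<in> out \<longrightarrow> y < t \<longrightarrow> (x, y) \<in> S"
        using out_source[OF less.prems False] .
      let ?w = "children u ! j"
      have w: "?w \<in> set (nodes T)" using child_in_nodes[OF u(1,3)] .
      have sc: "s \<le> last_time c" using less.IH[OF s] .
      then have "s \<in> times c" using out_key_first_time[OF s(2) c assms(4)] by (simp add: times_def)
      then have "?w \<in> set (nodes c) \<or> c \<in> set (nodes ?w)" using laminar[OF w c sj] by simp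
      moreover have "t \<in> times ?w" using endpoints_in_times(2)[OF w] tj by simp
      ultimately have sub: "times c \<subseteq> times ?w"
        using descendant_times_subset[OF c, of ?w] descendant_times_subset[OF w, of c] \<open>t \<notin> times c\<close> by blast
      then have ksub: "keys P c \<subseteq> keys P ?w" by (rule keys_mono)
      \<comment> \<open>The column belongs to child \<open>m\<close> and the row to child
        \<open>j\<close>; they coincide because child \<open>j\<close> contains \<open>c\<close>. So
        the raised columns of \<open>c\<close> lie in the very region whose top wing is
        considered.\<close>
      then have "m = j" using child_key_unique[OF u bm] assms(4) by blast
      have "last_time c \<in> times ?w" using endpoints_in_times(2)[OF c] sub by blast
      then have "(?l, last_time c) \<in> S \<inter> (keys P ?w \<times> times ?w)"
        "(?r, last_time c) \<in> S \<inter> (keys P ?w \<times> times ?w)"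
        using lr_keys ksub S top late by blast+
      from topwing_blocked[OF wing[unfolded \<open>m = j\<close>] _ this lr sc sc] show False
        by (simp add: times_def)
    qed
  qed
qed

text \<open>The responsible node \<open>u\<close> spans both column \<open>b\<close> and time
  \<open>t\<close>. The last hypothesis excludes that \<open>u\<close> lies in the subtree of
  \<open>w\<close>, so \<open>w\<close> lies below the child of \<open>u\<close> that ends at
  \<open>t\<close>.\<close>

lemma non_greedy_time:
  assumes "w \<in> set (nodes T)" "t \<in> times w" "(b, t) \<in> out" "\<not> greedy_at b t"
    and "b \<notin> keys P w \<or> is_leaf w"
  shows "t = last_time w"
proof -
  obtain u i j where u: "u \<in> set (nodes T)" "i < length (children u)" "j < length (children u)"
    and tj: "last_time (children u ! j) = t" and bi: "b \<in> keys P (children u ! i)"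
    using out_source[OF assms(3,4)] .
  let ?w = "children u ! j"
  have w: "?w \<in> set (nodes T)" using child_in_nodes[OF u(1,3)] .
  have tw: "t \<in> times ?w" using endpoints_in_times(2)[OF w] tj by simp
  then have tu: "t \<in> times u" using child_times_subset[OF u(1,3)] by blast
  have bu: "b \<in> keys P u" using keys_mono[OF child_times_subset[OF u(1,2)]] bi by blast
  have "u \<notin> set (nodes w)"
  proof
    assume *: "u \<in> set (nodes w)"
    then have "b \<in> keys P w" using keys_mono[OF descendant_times_subset[OF assms(1)]] bu by blast
    then have "children w = []" using assms(5) by (auto simp: is_leaf_def)
    then have "u = w" using * by (simp add: set_nodes[of w])
    then show False using \<open>children w = []\<close> u(2) by simp
  qed
  then have "w \<in> set (nodes u)" "w \<noteq> u" using laminar[OF assms(1) u(1) assms(2) tu] self_in_nodes[of w] by auto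
  then obtain m where m: "m < length (children u)" "w \<in> set (nodes (children u ! m))"
    by (rule proper_descendantE)
  have sub: "times w \<subseteq> times (children u ! m)"
    using descendant_times_subset[OF child_in_nodes[OF u(1) m(1)] m(2)] .
  then have "m = j" using child_unique[OF u(1) m(1) u(3) _ tw] assms(2) by blast
  then have "last_time w \<le> t" using sub endpoints_in_times(2)[OF assms(1)] tj by (auto simp: times_def)
  then show ?thesis using assms(2) by (simp add: times_def)
qed

text \<open>Compare the node \<open>u\<close> responsible for a point outside the Greedy phase with
  \<open>v\<close>. Below \<open>v\<close> it would place column and time in the same child; above
  \<open>v\<close> it acts inside \<open>v\<close> only when \<open>v\<close> ends; if it is
  \<open>v\<close>, the region already held an earlier point.\<close>

lemma sibling_point_cases:
  assumes "v \<in> set (nodes T)" "i < length (children v)" "j < length (children v)" "i \<noteq> j"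
    and "b \<in> keys P (children v ! i)" "t \<in> times (children v ! j)" "(b, t) \<in> out"
  obtains "greedy_at b t" | "t = last_time v"
  | s where "t = last_time (children v ! j)" "s < t" "s \<in> times (children v ! j)" "(b, s) \<in> out"
proof (cases "greedy_at b t")
  case False
  obtain u m l s where u: "u \<in> set (nodes T)" "m < length (children u)" "l < length (children u)"
    and tl: "last_time (children u ! l) = t" and bm: "b \<in> keys P (children u ! m)"
    and s: "s \<in> times (children u ! l)" "s < t" "(b, s) \<in> out"
    using out_source[OF assms(7) False] .
  have tw: "t \<in> times (children u ! l)" using endpoints_in_times(2)[OF child_in_nodes[OF u(1,3)]] tl by simp
  then have tu: "t \<in> times u" using child_times_subset[OF u(1,3)] by blast
  have bu: "b \<in> keys P u" using keys_mono[OF child_times_subset[OF u(1,2)]] bm by blast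
  have tv: "t \<in> times v" using child_times_subset[OF assms(1,3)] assms(6) by blast
  show ?thesis
  proof (cases "u = v")
    case True
    then have "l = j" using child_unique[OF assms(1), of l j t] u(3) tw assms(3,6) by simp
    then show ?thesis using that(3)[of s] True tl s by simp
  next
    case False
    have "u \<notin> set (nodes v)"
    proof
      assume "u \<in> set (nodes v)"
      then obtain k where k: "k < length (children v)" "u \<in> set (nodes (children v ! k))"
        using False by (rule proper_descendantE)
      have sub: "times u \<subseteq> times (children v ! k)"
        using descendant_times_subset[OF child_in_nodes[OF assms(1) k(1)] k(2)] .
      have "k = j" using child_unique[OF assms(1) k(1) assms(3) _ assms(6)] sub tu by blast
      moreover have "k = i" using child_key_unique[OF assms(1) k(1) assms(2) _ assms(5)] keys_mono[OF sub] bu by blast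
      ultimately show False using assms(4) by simp
    qed
    then have "v \<in> set (nodes u)" using laminar[OF assms(1) u(1) tv tu] by simp
    then obtain k where k: "k < length (children u)" "v \<in> set (nodes (children u ! k))"
      using False[symmetric] by (rule proper_descendantE)
    have sub: "times v \<subseteq> times (children u ! k)"
      using descendant_times_subset[OF child_in_nodes[OF u(1) k(1)] k(2)] .
    have "k = l" using child_unique[OF u(1) k(1) u(3) _ tw] sub tv by blast
    then have "last_time v \<le> t" using sub endpoints_in_times(2)[OF assms(1)] tl by (auto simp: times_def)
    then show ?thesis using that(2) tv by (simp add: times_def)
  qed
qed (rule that(1))

text \<open>
  The first access inside a block touches the nonempty column closest to the block on either side;
  from then on this column hides everything behind it.
\<close>

lemma later_greedy_outside_unique:
  assumes "w \<in> set (nodes T)" "t \<in> times w" "first_time w < t"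
    and "greedy_at b t" "greedy_at b' t" "b \<notin> keys P w"
    and order: "b' < b \<and> b < access P t \<or> access P t < b \<and> b < b'"
  shows False
proof -
  \<comment> \<open>Betweenness in either direction, so that columns to the left and to the right of
    the block are treated together.\<close>
  define btw where "btw x y z \<longleftrightarrow> x < y \<and> y < z \<or> z < y \<and> y < x" for x y z :: nat
  let ?a = "access P t" and ?f = "first_time w"
  have w: "1 \<le> ?f" "?f \<le> last_time w" "last_time w \<le> n" using node_bounds[OF assms(1)] .
  have tw: "t \<le> last_time w" using assms(2) by (simp add: times_def)
  have aw: "?a \<in> keys P w" using access_in_keys[OF assms(2)] .
  have fw: "access P ?f \<in> keys P w" using access_in_keys[OF endpoints_in_times(1)[OF assms(1)]] .
  have old: "x \<notin> keys P w" if "1 \<le> r" "r < ?f" "x = access P r" for x r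
    using access_in_keys_iff[OF assms(1), of r] that w by (simp add: times_def)
  \<comment> \<open>Columns opened before \<open>w\<close> starts, from \<open>b\<close> up to the
    block. The closest one, \<open>b0\<close>, is what the first access of \<open>w\<close> touches.
    Distances may be measured from the access at \<open>t\<close>: all accesses of \<open>w\<close>
    lie in one key interval, so the same outside columns separate them from
    \<open>b0\<close>.\<close>
  define C where "C c \<longleftrightarrow> (c = b \<or> btw b c ?a) \<and> (\<exists>r. 1 \<le> r \<and> r < ?f \<and> c = access P r)" for c
  have "C b"
  proof -
    have "touches out ?a t b" using assms(4) order by (auto simp: greedy_at_def)
    then obtain s where s: "s < t" "(b, s) \<in> out" unfolding touches_def by blast
    obtain r where r: "1 \<le> r" "r \<le> s" "b = access P r" using out_key_accessed[OF s(2)] by blast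
    have "r \<notin> times w" using access_in_keys[of r w] r(3) assms(6) by blast
    then have "r < ?f" using r(2) s(1) tw by (auto simp: times_def)
    then show ?thesis unfolding C_def using r by blast
  qed
  then obtain b0 where b0: "C b0" and b0_min: "\<And>c. C c \<Longrightarrow> max ?a b0 - min ?a b0 \<le> max ?a c - min ?a c"
    using ex_has_least_nat[of C b "\<lambda>c. max ?a c - min ?a c"] by auto
  obtain r0 where r0: "1 \<le> r0" "r0 < ?f" "b0 = access P r0" using b0 unfolding C_def by blast
  have b0w: "b0 \<notin> keys P w" using old[OF r0] .
  have b0_side: "b' < b0 \<and> b0 < ?a \<or> ?a < b0 \<and> b0 < b'"
    using order b0 unfolding C_def btw_def by auto
  have shields: "b' < b0 \<and> b0 < k \<or> k < b0 \<and> b0 < b'" if k: "k \<in> keys P w" for k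
    using b0_side keys_between[OF assms(1) k aw, of b0] keys_between[OF assms(1) aw k, of b0] b0w
    by (meson less_imp_le not_le)
  have "touches out (access P ?f) ?f b0"
  proof -
    define Y where "Y = {s. s < ?f \<and> (b0, s) \<in> out}"
    have fin: "finite Y" unfolding Y_def by simp
    have "r0 \<in> Y" unfolding Y_def using r0 access_out[of r0] w by simp
    then have Y: "Max Y \<in> Y" using fin Max_in by blast
    have "x = b0 \<and> y = Max Y" if xy: "(x, y) \<in> out" "Max Y \<le> y" "y < ?f"
      "min (access P ?f) b0 \<le> x" "x \<le> max (access P ?f) b0" for x y
    proof -
      obtain r where r: "1 \<le> r" "r \<le> y" "x = access P r" using out_key_accessed[OF xy(1)] by blast
      have rf: "r < ?f" using r xy(3) by simp
      have xw: "x \<notin> keys P w" using old[OF r(1) rf r(3)] .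
      have "x = b0"
      proof (rule ccontr)
        assume "x \<noteq> b0"
        moreover have "x \<noteq> access P ?f" using xw fw by blast
        ultimately have "b0 < x \<and> x < access P ?f \<or> access P ?f < x \<and> x < b0"
          using xy(4,5) by linarith
        then have "b0 < x \<and> x < ?a \<or> ?a < x \<and> x < b0"
          using keys_between[OF assms(1) fw aw, of x] keys_between[OF assms(1) aw fw, of x] xw
            b0_side shields[OF fw] by linarith
        then have "btw b x ?a" "max ?a x - min ?a x < max ?a b0 - min ?a b0"
          using b0 order unfolding C_def btw_def by auto
        then show False using b0_min[of x] r rf unfolding C_def by force
      qed
      then have "y \<in> Y" using xy unfolding Y_def by simp
      then show ?thesis using \<open>x = b0\<close> xy(2) Max_ge[OF fin] by fastforce
    qed
    then show ?thesis using Y unfolding touches_def Y_def by blast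
  qed
  then have first: "(b0, ?f) \<in> out" using greedy_at_out[of ?f b0] w by (simp add: greedy_at_def)
  \<comment> \<open>A touch of \<open>b'\<close> would rest on an older point of that column. If
    this is not after \<open>?f\<close>, the point of \<open>b0\<close> at \<open>?f\<close> hides
    it. Otherwise it lies inside the time interval of \<open>w\<close> but before its end, so it is
    itself a Greedy point, excluded by induction.\<close>
  have "?f < s \<Longrightarrow> s \<le> t \<Longrightarrow> \<not> greedy_at b' s" for s
  proof (induction s rule: less_induct)
    case (less s)
    show ?case
    proof
      assume g: "greedy_at b' s"
      have "s \<in> times w" using less.prems tw by (simp add: times_def)
      then have as: "access P s \<in> keys P w" by (rule access_in_keys)
      then have side: "b' < b0 \<and> b0 < access P s \<or> access P s < b0 \<and> b0 < b'" by (rule shields)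
      then have "touches out (access P s) s b'" using g by (auto simp: greedy_at_def)
      then obtain r where r: "r < s" "(b', r) \<in> out"
        and only: "\<And>x y. (x, y) \<in> out \<Longrightarrow> r \<le> y \<Longrightarrow> y < s \<Longrightarrow> min (access P s) b' \<le> x \<Longrightarrow>
          x \<le> max (access P s) b' \<Longrightarrow> x = b' \<and> y = r"
        unfolding touches_def by blast
      show False
      proof (cases "r \<le> ?f")
        case True
        then show False using only[OF first] less.prems side by auto
      next
        case False
        have "b' \<notin> keys P w"
          using keys_between[OF assms(1) _ as, of b' b0] keys_between[OF assms(1) as, of b' b0] b0w side by auto
        moreover have "r \<in> times w" "r \<noteq> last_time w" using False r(1) less.prems tw by (auto simp: times_def)
        ultimately have "greedy_at b' r" using non_greedy_time[OF assms(1) _ r(2)] by blast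
        then show False using less.IH[OF r(1)] False r(1) less.prems by simp
      qed
    qed
  qed
  then show False using assms(3,5) by blast
qed

definition later_greedy_outside :: "point set" where
  "later_greedy_outside = {(b, t). t \<in> {1..n} \<and> greedy_at b t \<and>
     (\<exists>w\<in>set (nodes T). t \<in> times w \<and> first_time w < t \<and> b \<notin> keys P w)}"

text \<open>At most one point per time and side, which gives the factor 2. Two points on the same
  side may come with different blocks; the block of the column nearer to the access is the one to
  apply.\<close>

lemma card_later_greedy_outside: "card later_greedy_outside \<le> 2 * n"
proof -
  let ?f = "\<lambda>(b, t). (t, b < access P t)"
  have "inj_on ?f later_greedy_outside"
  proof (rule inj_onI)
    fix z z' assume zz: "z \<in> later_greedy_outside" "z' \<in> later_greedy_outside" "?f z = ?f z'"
    obtain b t where z: "z = (b, t)" by (cases z)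
    obtain b' where z': "z' = (b', t)" using zz(3) by (cases z') (simp add: z)
    have side: "b < access P t \<longleftrightarrow> b' < access P t" using zz(3) by (simp add: z z')
    obtain w where w: "w \<in> set (nodes T)" "t \<in> times w" "first_time w < t" "b \<notin> keys P w" "greedy_at b t"
      using zz(1) unfolding later_greedy_outside_def z by blast
    obtain w' where w': "w' \<in> set (nodes T)" "t \<in> times w'" "first_time w' < t" "b' \<notin> keys P w'" "greedy_at b' t"
      using zz(2) unfolding later_greedy_outside_def z' by blast
    have "b \<noteq> access P t" "b' \<noteq> access P t" using w w' access_in_keys by blast+
    then have "b = b' \<or> (b' < b \<and> b < access P t \<or> access P t < b \<and> b < b') \<or>
      (b < b' \<and> b' < access P t \<or> access P t < b' \<and> b' < b)"
      using side by linarith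
    then have "b = b'"
      using later_greedy_outside_unique[OF w(1-3) w(5) w'(5) w(4)]
        later_greedy_outside_unique[OF w'(1-3) w'(5) w(5) w'(4)] by blast
    then show "z = z'" using z z' by simp
  qed
  moreover have "?f ` later_greedy_outside \<subseteq> {1..n} \<times> UNIV"
    unfolding later_greedy_outside_def by auto
  ultimately have "card later_greedy_outside \<le> card ({1..n} \<times> (UNIV :: bool set))"
    by (rule card_inj_on_le) simp
  then show ?thesis by (simp add: card_cartesian_product)
qed

subsection \<open>Simulation of the skeleton\<close>

text \<open>Greedy on the smallest keys themselves instead of their ranks: the size is the same by
  \<open>greedy_pattern\<close>, but the columns are actual keys of the children.\<close>

definition skeleton_output :: "block_tree \<Rightarrow> point set" where
  "skeleton_output v = greedy_output (map (\<lambda>c. Min (keys P c)) (children v)) (length (children v))"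

lemma card_skeleton_output: "card (skeleton_output v) = greedy (skeleton P v)"
  unfolding skeleton_def greedy_pattern by (simp add: greedy_def skeleton_output_def)

text \<open>Both indices number the children in time order from 0, whereas skeleton times start at
  1; hence \<open>Suc j\<close>.\<close>

definition active :: "block_tree \<Rightarrow> nat \<Rightarrow> nat \<Rightarrow> bool" where
  "active v i j \<longleftrightarrow> i < length (children v) \<and> j < length (children v) \<and>
     (Min (keys P (children v ! i)), Suc j) \<in> skeleton_output v"

text \<open>Disjoint intervals compare alike whichever representatives are taken. This transfers
  positions between columns of \<open>out\<close> and columns of the skeleton.\<close>

lemma child_order:
  assumes "v \<in> set (nodes T)" "i < length (children v)" "j < length (children v)"
    and "b \<in> keys P (children v ! i)" "c \<in> keys P (children v ! j)" "i \<noteq> j"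
  shows "b < c \<longleftrightarrow> Min (keys P (children v ! i)) < Min (keys P (children v ! j))"
proof -
  have *: "Min (keys P (children v ! i)) < Min (keys P (children v ! j))"
    if ij: "i < length (children v)" "j < length (children v)" "i \<noteq> j"
      and "b \<in> keys P (children v ! i)" "c \<in> keys P (children v ! j)" "b < c" for i j b c
  proof (rule ccontr)
    let ?Ki = "keys P (children v ! i)" and ?Kj = "keys P (children v ! j)"
    assume "\<not> Min ?Ki < Min ?Kj"
    then have le: "Min ?Kj \<le> b" using Min_le[OF finite_keys that(4)] by linarith
    have node: "children v ! j \<in> set (nodes T)" using child_in_nodes[OF assms(1) ij(2)] .
    have "b \<in> ?Kj"
      using keys_between[OF node Min_in[OF finite_keys keys_nonempty[OF node]] that(5) le] that(6) by linarith
    from child_key_unique[OF assms(1) ij(1,2) that(4) this] ij(3) show False by contradiction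
  qed
  have "b \<noteq> c"
  proof
    assume "b = c"
    with child_key_unique[OF assms(1-4)] assms(5,6) show False by simp
  qed
  then show ?thesis
    using *[OF assms(2,3,6,4,5)] *[OF assms(3,2) assms(6)[symmetric] assms(5,4)] by linarith
qed

lemma Min_keys_inj:
  assumes "v \<in> set (nodes T)" "i < length (children v)" "j < length (children v)"
    and "Min (keys P (children v ! i)) = Min (keys P (children v ! j))"
  shows "i = j"
proof -
  have "Min (keys P (children v ! k)) \<in> keys P (children v ! k)" if "k < length (children v)" for k
    using Min_in[OF finite_keys keys_nonempty[OF child_in_nodes[OF assms(1) that]]] .
  then show ?thesis using child_key_unique[OF assms(1-3)] assms(2-4) by metis
qed

lemma skeleton_output_iff:
  assumes "j < length (children v)"
  shows "(b, Suc j) \<in> skeleton_output v \<longleftrightarrow> b = Min (keys P (children v ! j)) \<or>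
     touches (skeleton_output v) (Min (keys P (children v ! j))) (Suc j) b"
  using greedy_output_iff[of "Suc j" "map (\<lambda>c. Min (keys P c)) (children v)" b] assms
  by (simp add: skeleton_output_def access_def del: greedy_output.simps)

lemma skeleton_outputE:
  assumes "(x, y) \<in> skeleton_output v"
  obtains i j where "active v i j" "x = Min (keys P (children v ! i))" "y = Suc j"
proof -
  have "(x, y) \<in> set (map (\<lambda>c. Min (keys P c)) (children v)) \<times> {1..length (children v)}"
    using assms greedy_output_subset[of "length (children v)" "map (\<lambda>c. Min (keys P c)) (children v)"]
    unfolding skeleton_output_def by auto
  then obtain c where c: "c \<in> set (children v)" "x = Min (keys P c)" and y: "1 \<le> y" "y \<le> length (children v)" by auto
  obtain i where i: "i < length (children v)" "c = children v ! i" using c(1) by (metis in_set_conv_nth)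
  obtain j where "y = Suc j" using y(1) by (cases y) auto
  then show ?thesis using that[of i j] i c y assms unfolding active_def by simp
qed

lemma active_self: "j < length (children v) \<Longrightarrow> active v j j"
  unfolding active_def by (simp add: skeleton_output_iff)

text \<open>The touch rule of the skeleton in terms of child indices, so that it can be matched with
  touches between regions.\<close>

lemma active_iff:
  assumes "v \<in> set (nodes T)" "i < length (children v)" "j < length (children v)" "i \<noteq> j"
  defines "\<mu> \<equiv> \<lambda>i. Min (keys P (children v ! i))"
  shows "active v i j \<longleftrightarrow> (\<exists>s<j. active v i s \<and>
     (\<forall>i' j'. active v i' j' \<longrightarrow> s \<le> j' \<longrightarrow> j' < j \<longrightarrow> min (\<mu> j) (\<mu> i) \<le> \<mu> i' \<longrightarrow>
        \<mu> i' \<le> max (\<mu> j) (\<mu> i) \<longrightarrow> i' = i \<and> j' = s))" (is "_ \<longleftrightarrow> ?R")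
proof -
  have "\<mu> i \<noteq> \<mu> j" using Min_keys_inj[OF assms(1-3)] assms(4) unfolding \<mu>_def by blast
  then have *: "active v i j \<longleftrightarrow> touches (skeleton_output v) (\<mu> j) (Suc j) (\<mu> i)"
    unfolding active_def using skeleton_output_iff[OF assms(3)] assms(2,3) by (simp add: \<mu>_def)
  have inj: "i' = i" if "active v i' j'" "\<mu> i' = \<mu> i" for i' j'
    using Min_keys_inj[OF assms(1) _ assms(2)] that unfolding active_def \<mu>_def by blast
  show ?thesis unfolding *
  proof
    assume "touches (skeleton_output v) (\<mu> j) (Suc j) (\<mu> i)"
    then obtain y where y: "y < Suc j" "(\<mu> i, y) \<in> skeleton_output v"
      and only: "\<And>x z. (x, z) \<in> skeleton_output v \<Longrightarrow> y \<le> z \<Longrightarrow> z < Suc j \<Longrightarrow> min (\<mu> j) (\<mu> i) \<le> x \<Longrightarrow>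
          x \<le> max (\<mu> j) (\<mu> i) \<Longrightarrow> x = \<mu> i \<and> z = y"
      unfolding touches_def by blast
    obtain i0 s where s: "active v i0 s" "\<mu> i = \<mu> i0" "y = Suc s"
      using skeleton_outputE[OF y(2)] unfolding \<mu>_def by blast
    have "i0 = i" using inj[OF s(1)] s(2) by simp
    show ?R
    proof (intro exI[of _ s] conjI allI impI)
      show "s < j" "active v i s" using s y \<open>i0 = i\<close> by auto
      fix i' j' assume a: "active v i' j'" "s \<le> j'" "j' < j" "min (\<mu> j) (\<mu> i) \<le> \<mu> i'" "\<mu> i' \<le> max (\<mu> j) (\<mu> i)"
      have "(\<mu> i', Suc j') \<in> skeleton_output v" using a(1) unfolding active_def \<mu>_def by simp
      then have "\<mu> i' = \<mu> i \<and> Suc j' = y" using only[of "\<mu> i'" "Suc j'"] a s(3) by simp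
      then show "i' = i" "j' = s" using inj[OF a(1)] s(3) by auto
    qed
  next
    assume ?R
    then obtain s where s: "s < j" "active v i s"
      and only: "\<And>i' j'. active v i' j' \<Longrightarrow> s \<le> j' \<Longrightarrow> j' < j \<Longrightarrow> min (\<mu> j) (\<mu> i) \<le> \<mu> i' \<Longrightarrow>
         \<mu> i' \<le> max (\<mu> j) (\<mu> i) \<Longrightarrow> i' = i \<and> j' = s"
      by blast
    show "touches (skeleton_output v) (\<mu> j) (Suc j) (\<mu> i)"
      unfolding touches_def
    proof (intro exI[of _ "Suc s"] conjI allI impI)
      show "Suc s < Suc j" "(\<mu> i, Suc s) \<in> skeleton_output v" using s unfolding active_def \<mu>_def by auto
      fix x y assume a: "(x, y) \<in> skeleton_output v" "Suc s \<le> y" "y < Suc j"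
        "min (\<mu> j) (\<mu> i) \<le> x" "x \<le> max (\<mu> j) (\<mu> i)"
      obtain i' j' where ij: "active v i' j'" "x = \<mu> i'" "y = Suc j'"
        using skeleton_outputE[OF a(1)] unfolding \<mu>_def by blast
      then have "i' = i \<and> j' = s" using only[of i' j'] a by simp
      then show "x = \<mu> i" "y = Suc s" using ij by auto
    qed
  qed
qed

text \<open>A skeleton column opens only with its own access. Hence in rows before \<open>j\<close>
  no active column is that of child \<open>j\<close>.\<close>

lemma active_le:
  assumes "v \<in> set (nodes T)" "active v i j"
  shows "i \<le> j"
  using assms(2)
proof (induction j rule: less_induct)
  case (less j)
  show ?case
  proof (cases "i = j")
    case False
    have "i < length (children v)" "j < length (children v)" using less.prems by (auto simp: active_def)
    then obtain s where "s < j" "active v i s" using active_iff[OF assms(1) _ _ False] less.prems by blast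
    then show ?thesis using less.IH[of s] by simp
  qed simp
qed

text \<open>
  The nonempty regions of a node are exactly the greedy output of its skeleton. The nodes
  above \<open>v\<close> may add points to further regions, but only at the last time of \<open>v\<close>.
\<close>

lemma regions_simulate_skeleton:
  assumes v: "v \<in> set (nodes T)"
  shows "j < length (children v) \<Longrightarrow>
    (\<forall>i<length (children v). i \<noteq> j \<longrightarrow> \<not> active v i j \<longrightarrow>
       (\<forall>b\<in>keys P (children v ! i). \<forall>t\<in>times (children v ! j).
          \<not> greedy_at b t \<and> (t < last_time v \<longrightarrow> (b, t) \<notin> out))) \<and>
    (\<forall>i. active v i j \<longrightarrow>
       (\<exists>b\<in>keys P (children v ! i). (b, last_time (children v ! j)) \<in> out))"
proof (induction j rule: less_induct)
  case (less j)
  define c where "c i = children v ! i" for i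
  define k where "k = length (children v)"
  define \<mu> where "\<mu> i = Min (keys P (c i))" for i
  have j: "j < k" using less.prems by (simp add: k_def)
  have node: "c i \<in> set (nodes T)" if "i < k" for i
    using child_in_nodes[OF v] that by (simp add: c_def k_def)
  have nl: "\<not> is_leaf v" using j by (auto simp: is_leaf_def k_def)
  have less_times: "last_time (c i) < first_time (c i')" if "i < i'" "i' < k" for i i'
    using children_less[OF v] that by (simp add: c_def k_def)
  have bounds: "first_time (c i) \<le> last_time (c i)" "last_time (c i) \<le> last_time v" "first_time v \<le> first_time (c i)" if "i < k" for i
    using child_times_subset[OF v, of i] endpoints_in_times[OF node[OF that]] node_bounds(2)[OF node[OF that]] that
    by (auto simp: c_def k_def times_def subset_iff)
  have kuniq: "i = i'" if "i < k" "i' < k" "b \<in> keys P (c i)" "b \<in> keys P (c i')" for i i' b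
    using child_key_unique[OF v] that by (auto simp: c_def k_def)
  have ord: "b < b' \<longleftrightarrow> \<mu> i < \<mu> i'" if "i < k" "i' < k" "b \<in> keys P (c i)" "b' \<in> keys P (c i')" "i \<noteq> i'" for i i' b b'
    unfolding \<mu>_def c_def by (rule child_order[OF v]) (use that in \<open>auto simp: c_def k_def\<close>)
  have act: "active v i j' \<Longrightarrow> i < k \<and> j' < k \<and> i \<le> j'" for i j'
    using active_le[OF v] unfolding active_def k_def by blast
  have iff: "active v i j \<longleftrightarrow> (\<exists>s<j. active v i s \<and>
     (\<forall>i' j'. active v i' j' \<longrightarrow> s \<le> j' \<longrightarrow> j' < j \<longrightarrow> min (\<mu> j) (\<mu> i) \<le> \<mu> i' \<longrightarrow>
        \<mu> i' \<le> max (\<mu> j) (\<mu> i) \<longrightarrow> i' = i \<and> j' = s))" if "i < k" "i \<noteq> j" for i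
    using active_iff[OF v _ less.prems that(2)] that(1) by (simp add: k_def \<mu>_def c_def)
  \<comment> \<open>The reservation about the last time of \<open>v\<close> disappears here: a row
    before row \<open>j\<close> ends before \<open>v\<close> does.\<close>
  have IH1: "active v i j'" if "j' < j" "i < k" "b \<in> keys P (c i)" "t \<in> times (c j')" "(b, t) \<in> out" for i j' b t
  proof (cases "i = j'")
    case True
    then show ?thesis using active_self that j by (simp add: k_def)
  next
    case False
    have "t \<le> last_time (c j')" using that(4) by (simp add: times_def)
    also have "\<dots> < first_time (c j)" using less_times that j by simp
    also have "\<dots> \<le> last_time v" using bounds[OF j] by linarith
    finally have "t < last_time v" .
    then show ?thesis using less.IH[OF that(1)] that j False unfolding c_def k_def by (meson less_trans)
  qed
  have IH2: "\<exists>b\<in>keys P (c i). (b, last_time (c j')) \<in> out" if "j' < j" "active v i j'" for i j'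
    using less.IH[OF that(1)] that j unfolding c_def k_def by simp
  have locate: "\<exists>j'\<le>j. t \<in> times (c j')" if "i < k" "b \<in> keys P (c i)" "(b, t) \<in> out" "t \<le> last_time (c j)" for i b t
  proof -
    have "first_time v \<le> t" using out_key_first_time[OF that(3) node[OF that(1)] that(2)] bounds[OF that(1)] by linarith
    then have "t \<in> times v" using that(4) bounds[OF j] by (simp add: times_def)
    then obtain j' where j': "j' < k" "t \<in> times (c j')"
      using child_cover[OF v nl] unfolding c_def k_def by metis
    have "\<not> j < j'"
      using less_times[of j j'] j' that(4) by (auto simp: times_def)
    then show ?thesis using j' by (auto simp: not_less)
  qed
  have inactive: "\<not> greedy_at b t \<and> (t < last_time v \<longrightarrow> (b, t) \<notin> out)"
    if i: "i < k" "i \<noteq> j" "\<not> active v i j" "b \<in> keys P (c i)" and t: "t \<in> times (c j)" for i b t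
    using t
  proof (induction t rule: less_induct)
    case (less t)
    have a: "access P t \<in> keys P (c j)" using access_in_keys[OF less.prems] .
    have not_greedy: "\<not> greedy_at b t"
    proof
      assume "greedy_at b t"
      moreover have "b \<noteq> access P t" using kuniq[OF i(1) j i(4)] a i(2) by blast
      ultimately have "touches out (access P t) t b" by (simp add: greedy_at_def)
      then obtain s where s: "s < t" "(b, s) \<in> out"
        and only: "\<And>x y. (x, y) \<in> out \<Longrightarrow> s \<le> y \<Longrightarrow> y < t \<Longrightarrow> min (access P t) b \<le> x \<Longrightarrow>
          x \<le> max (access P t) b \<Longrightarrow> x = b \<and> y = s"
        unfolding touches_def by blast
      have tl: "t \<le> last_time (c j)" "first_time (c j) \<le> t" using less.prems by (auto simp: times_def)
      then obtain j0 where j0: "j0 \<le> j" "s \<in> times (c j0)"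
        using locate[OF i(1,4) s(2)] s(1) by auto
      have "j0 \<noteq> j"
      proof
        assume "j0 = j"
        then show False using less.IH[OF s(1)] j0 s tl bounds[OF j] by simp
      qed
      then have "j0 < j" using j0 by simp
      then have "active v i j0" using IH1[OF _ i(1,4) j0(2) s(2)] by simp
      \<comment> \<open>The latest earlier row in which column \<open>i\<close> is active is the
        candidate for a touch in the skeleton. As \<open>(i, j)\<close> is not active, another
        active pair must lie in its rectangle.\<close>
      define A where "A = {s. s < j \<and> active v i s}"
      have fin: "finite A" by (simp add: A_def)
      have "j0 \<in> A" using \<open>j0 < j\<close> \<open>active v i j0\<close> by (simp add: A_def)
      then have "A \<noteq> {}" by blast
      have MA: "Max A \<in> A" "j0 \<le> Max A" using Max_in[OF fin \<open>A \<noteq> {}\<close>] Max_ge[OF fin \<open>j0 \<in> A\<close>] .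
      then obtain i' j' where ij: "active v i' j'" "Max A \<le> j'" "j' < j"
        and pos: "min (\<mu> j) (\<mu> i) \<le> \<mu> i'" "\<mu> i' \<le> max (\<mu> j) (\<mu> i)" and ne: "\<not> (i' = i \<and> j' = Max A)"
        using i(3) iff[OF i(1,2)] unfolding A_def by blast
      have "i' \<noteq> i"
      proof
        assume "i' = i"
        then have "j' \<in> A" using ij by (simp add: A_def)
        then have "j' = Max A" using Max_ge[OF fin] ij(2) by force
        then show False using ne \<open>i' = i\<close> by simp
      qed
      have "i' \<noteq> j" "i' < k" using act[OF ij(1)] ij(3) by auto
      obtain b' where b': "b' \<in> keys P (c i')" "(b', last_time (c j')) \<in> out"
        using IH2[OF ij(3,1)] by blast
      have "s \<le> last_time (c j0)" using j0 by (simp add: times_def)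
      \<comment> \<open>If both regions share a row, the point of \<open>i'\<close> still is not
        older than \<open>s\<close>, because it lies at the last time of that row.\<close>
      moreover have "last_time (c j0) \<le> last_time (c j')"
      proof (cases "j0 = j'")
        case False
        then have "j0 < j'" "j' < k" using MA ij j by auto
        then show ?thesis using less_times[of j0 j'] bounds[of j'] by simp
      qed simp
      moreover have "last_time (c j') < t" using less_times[OF ij(3) j] tl by simp
      moreover have "min (access P t) b \<le> b'" "b' \<le> max (access P t) b"
        using pos ord[OF i(1) \<open>i' < k\<close> i(4) b'(1) \<open>i' \<noteq> i\<close>[symmetric]] ord[OF \<open>i' < k\<close> i(1) b'(1) i(4) \<open>i' \<noteq> i\<close>]
          ord[OF \<open>i' < k\<close> j b'(1) a \<open>i' \<noteq> j\<close>] ord[OF j \<open>i' < k\<close> a b'(1) \<open>i' \<noteq> j\<close>[symmetric]]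
        by linarith+
      ultimately have "b' = b" using only[OF b'(2)] by simp
      then show False using kuniq[OF i(1) \<open>i' < k\<close> i(4)] b'(1) \<open>i' \<noteq> i\<close> by blast
    qed
    moreover have "(b, t) \<notin> out" if early: "t < last_time v"
    proof
      assume bt: "(b, t) \<in> out"
      show False
        using v i(1)[unfolded k_def] j[unfolded k_def] i(2) i(4)[unfolded c_def] less.prems[unfolded c_def] bt
      proof (rule sibling_point_cases)
        fix s assume s: "s < t" "s \<in> times (children v ! j)" "(b, s) \<in> out"
        then show False using less.IH[OF s(1)] early by (simp add: c_def)
      qed (use not_greedy early in auto)
    qed
    ultimately show ?case by blast
  qed
  have reached: "\<exists>b\<in>keys P (c i). (b, last_time (c j)) \<in> out" if ij: "active v i j" for i
  proof (cases "i = j")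
    case True
    then show ?thesis
      using extreme_column_end[OF v less.prems] Min_in[OF finite_keys keys_nonempty[OF node[OF j]]]
      unfolding c_def by blast
  next
    case False
    have i: "i < k" using act[OF ij] by simp
    obtain s where s: "s < j" "active v i s"
      and only: "\<And>i' j'. active v i' j' \<Longrightarrow> s \<le> j' \<Longrightarrow> j' < j \<Longrightarrow> min (\<mu> j) (\<mu> i) \<le> \<mu> i' \<Longrightarrow>
         \<mu> i' \<le> max (\<mu> j) (\<mu> i) \<Longrightarrow> i' = i \<and> j' = s"
      using ij unfolding iff[OF i False] by blast
    \<comment> \<open>Already the first access of row \<open>j\<close> touches the region; its top
      wing then provides the point at the end of the row.\<close>
    define t where "t = first_time (c j)"
    define a where "a = access P t"
    have tj: "t \<in> times (c j)" unfolding t_def using endpoints_in_times(1)[OF node[OF j]] .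
    have a: "a \<in> keys P (c j)" unfolding a_def using access_in_keys[OF tj] .
    \<comment> \<open>Child \<open>i\<close> may hold several points at the end of row
      \<open>s\<close>. The one closest to the access is touched, since it has none of the others
      between itself and the access.\<close>
    define B where "B b \<longleftrightarrow> b \<in> keys P (c i) \<and> (b, last_time (c s)) \<in> out" for b
    obtain b1 where "B b1" using IH2[OF s] unfolding B_def by blast
    then obtain b where b: "B b" and b_min: "\<And>x. B x \<Longrightarrow> max a b - min a b \<le> max a x - min a x"
      using ex_has_least_nat[of B b1 "\<lambda>x. max a x - min a x"] by auto
    have bi: "b \<in> keys P (c i)" using b by (simp add: B_def)
    have st: "last_time (c s) < t" unfolding t_def using less_times[OF s(1) j] .
    have "touches out a t b"
      unfolding touches_def
    proof (intro exI[of _ "last_time (c s)"] conjI allI impI)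
      show "last_time (c s) < t" "(b, last_time (c s)) \<in> out" using st b by (auto simp: B_def)
      fix x y assume xy: "(x, y) \<in> out" "last_time (c s) \<le> y" "y < t" "min a b \<le> x" "x \<le> max a b"
      have "a \<in> keys P v" "b \<in> keys P v"
        using keys_mono[OF child_times_subset[OF v]] a bi i j unfolding c_def k_def by blast+
      then have "x \<in> keys P v"
        using keys_between[OF v, of a b x] keys_between[OF v, of b a x] xy(4,5) by linarith
      then obtain i' where i': "i' < k" "x \<in> keys P (c i')"
        using child_key_cover[OF v nl] unfolding c_def k_def by metis
      have "y \<le> last_time (c j)" using xy(3) bounds(1)[OF j] unfolding t_def by linarith
      then obtain j' where j': "j' \<le> j" "y \<in> times (c j')"
        using locate[OF i' xy(1)] by blast
      have "j' \<noteq> j" using j'(2) xy(3) unfolding t_def times_def by auto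
      then have j'j: "j' < j" using j' by simp
      have "\<not> j' < s" using less_times[of j' s] j'(2) xy(2) s j bounds(1)[of s] by (auto simp: times_def)
      then have "s \<le> j'" by simp
      have "active v i' j'" using IH1[OF j'j i' j'(2) xy(1)] .
      then have "i' \<noteq> j" using act j'j by fastforce
      have "min (\<mu> j) (\<mu> i) \<le> \<mu> i'" "\<mu> i' \<le> max (\<mu> j) (\<mu> i)"
      proof -
        have "i' = i \<or> min (\<mu> j) (\<mu> i) \<le> \<mu> i' \<and> \<mu> i' \<le> max (\<mu> j) (\<mu> i)"
          using ord[OF i' (1) i i'(2) bi] ord[OF i i'(1) bi i'(2)] xy(4,5)
            ord[OF i'(1) j i'(2) a \<open>i' \<noteq> j\<close>] ord[OF j i'(1) a i'(2) \<open>i' \<noteq> j\<close>[symmetric]] by linarith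
        then show "min (\<mu> j) (\<mu> i) \<le> \<mu> i'" "\<mu> i' \<le> max (\<mu> j) (\<mu> i)" by auto
      qed
      then have eq: "i' = i" "j' = s"
        using only[OF \<open>active v i' j'\<close> \<open>s \<le> j'\<close> j'j] by auto
      then show y: "y = last_time (c s)" using j'(2) xy(2) by (simp add: times_def)
      then have "B x" using i' eq xy(1) by (simp add: B_def)
      then show "x = b" using b_min[of x] xy(4,5) by linarith
    qed
    then have g: "greedy_at b t" by (simp add: greedy_at_def a_def)
    moreover have "t \<in> {1..n}" using times_subset[OF node[OF j]] tj by blast
    ultimately have bt: "(b, t) \<in> out" by (intro greedy_at_out)
    obtain b' where "b' \<in> keys P (children v ! i)" "(b', last_time (children v ! j)) \<in> out"
      using topwing_nonempty[OF v i[unfolded k_def] less.prems bt bi[unfolded c_def] tj[unfolded c_def]] g by blast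
    then show ?thesis unfolding c_def by blast
  qed
  show ?case using inactive reached unfolding c_def k_def by blast
qed

lemma active_regionI:
  assumes "v \<in> set (nodes T)" "i < length (children v)" "j < length (children v)" "i \<noteq> j"
    and "b \<in> keys P (children v ! i)" "t \<in> times (children v ! j)"
    and "greedy_at b t \<or> t < last_time v \<and> (b, t) \<in> out"
  shows "active v i j"
  using regions_simulate_skeleton[OF assms(1,3)] assms(2,4-7) by blast

subsection \<open>Counting\<close>

text \<open>The columns of the block are empty before it starts, top wings reach it only at its last
  time, and rectangles between two of its keys stay inside it. So the Greedy phase acts as Greedy on
  the restricted sequence, with times shifted to start at 1; this includes the last time, where the
  wings come after that phase.\<close>

lemma leaf_greedy_iff:
  assumes w: "w \<in> set (nodes T)" "is_leaf w"
  defines "rs \<equiv> map (access P) [first_time w..<Suc (last_time w)]"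
  defines "Gr \<equiv> greedy_output rs (length rs)"
  shows "t \<in> times w \<Longrightarrow> b \<in> keys P w \<Longrightarrow> greedy_at b t \<longleftrightarrow> (b, Suc t - first_time w) \<in> Gr"
proof (induction t arbitrary: b rule: less_induct)
  case (less t)
  let ?f = "first_time w" and ?a = "access P t"
  have t: "?f \<le> t" "t \<le> last_time w" using less.prems(1) by (auto simp: times_def)
  have len: "length rs = Suc (last_time w) - ?f" by (simp add: rs_def del: upt_Suc)
  have acc: "access rs (Suc t - ?f) = ?a"
  proof -
    have "access rs (Suc t - ?f) = rs ! (t - ?f)" unfolding access_def by simp
    also have "\<dots> = ?a" using t by (simp add: rs_def del: upt_Suc)
    finally show ?thesis .
  qed
  have Gr_sub: "x \<in> keys P w \<and> 1 \<le> y" if "(x, y) \<in> Gr" for x y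
    using that greedy_output_subset[of "length rs" rs] unfolding Gr_def rs_def keys_def times_def
    by (auto simp del: upt_Suc)
  have aw: "?a \<in> keys P w" using access_in_keys[OF less.prems(1)] .
  have out_iff: "(x, y) \<in> out \<longleftrightarrow> ?f \<le> y \<and> (x, Suc y - ?f) \<in> Gr" if xy: "y < t" "x \<in> keys P w" for x y
  proof (cases "?f \<le> y")
    case True
    then have y: "y \<in> times w" "y \<noteq> last_time w" using xy t by (auto simp: times_def)
    then have "(x, y) \<in> out \<longleftrightarrow> greedy_at x y"
      using non_greedy_time[OF w(1) y(1), of x] greedy_at_out[of y x] times_subset[OF w(1)] w(2) by blast
    then show ?thesis using less.IH[OF xy(1) y(1) xy(2)] True by simp
  next
    case False
    then show ?thesis using out_key_first_time[OF _ w(1) xy(2)] by blast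
  qed
  have between: "x \<in> keys P w" if "min ?a b \<le> x" "x \<le> max ?a b" for x
    using keys_between[OF w(1) aw less.prems(2), of x] keys_between[OF w(1) less.prems(2) aw, of x] that by linarith
  have "touches out ?a t b \<longleftrightarrow> touches Gr ?a (Suc t - ?f) b"
  proof
    assume "touches out ?a t b"
    then obtain s where s: "s < t" "(b, s) \<in> out"
      and only: "\<And>x y. (x, y) \<in> out \<Longrightarrow> s \<le> y \<Longrightarrow> y < t \<Longrightarrow> min ?a b \<le> x \<Longrightarrow> x \<le> max ?a b \<Longrightarrow> x = b \<and> y = s"
      unfolding touches_def by blast
    have sf: "?f \<le> s" "(b, Suc s - ?f) \<in> Gr" using out_iff[OF s(1) less.prems(2)] s(2) by auto
    show "touches Gr ?a (Suc t - ?f) b"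
      unfolding touches_def
    proof (intro exI[of _ "Suc s - ?f"] conjI allI impI)
      show "Suc s - ?f < Suc t - ?f" "(b, Suc s - ?f) \<in> Gr" using s sf by auto
      fix x y assume xy: "(x, y) \<in> Gr" "Suc s - ?f \<le> y" "y < Suc t - ?f" "min ?a b \<le> x" "x \<le> max ?a b"
      define z where "z = y + ?f - 1"
      have z: "s \<le> z" "z < t" "?f \<le> z" "Suc z - ?f = y" using Gr_sub[OF xy(1)] xy(2,3) sf(1) unfolding z_def by auto
      then have "(x, z) \<in> out" using out_iff[OF z(2) between[OF xy(4,5)]] xy(1) by simp
      then have "x = b \<and> z = s" using only[of x z] z xy by blast
      then show "x = b" "y = Suc s - ?f" using z by auto
    qed
  next
    assume "touches Gr ?a (Suc t - ?f) b"
    then obtain y0 where y0: "y0 < Suc t - ?f" "(b, y0) \<in> Gr"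
      and only: "\<And>x y. (x, y) \<in> Gr \<Longrightarrow> y0 \<le> y \<Longrightarrow> y < Suc t - ?f \<Longrightarrow> min ?a b \<le> x \<Longrightarrow> x \<le> max ?a b \<Longrightarrow> x = b \<and> y = y0"
      unfolding touches_def by blast
    define s where "s = y0 + ?f - 1"
    have s: "s < t" "?f \<le> s" "Suc s - ?f = y0" using Gr_sub[OF y0(2)] y0(1) unfolding s_def by auto
    show "touches out ?a t b"
      unfolding touches_def
    proof (intro exI[of _ s] conjI allI impI)
      show "s < t" "(b, s) \<in> out" using s y0(2) out_iff[OF s(1) less.prems(2)] by auto
      fix x y assume xy: "(x, y) \<in> out" "s \<le> y" "y < t" "min ?a b \<le> x" "x \<le> max ?a b"
      have y: "?f \<le> y" "(x, Suc y - ?f) \<in> Gr" using out_iff[OF xy(3) between[OF xy(4,5)]] xy(1) by auto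
      have "y0 \<le> Suc y - ?f" "Suc y - ?f < Suc t - ?f" using s xy(2,3) y(1) by auto
      then have "x = b \<and> Suc y - ?f = y0" using only[OF y(2)] xy(4,5) by blast
      then show "x = b" "y = s" using s y(1) by auto
    qed
  qed
  then show ?case
    unfolding greedy_at_def Gr_def
    using greedy_output_iff[of "Suc t - ?f" rs b] t len acc by (simp add: Gr_def)
qed

definition leaf_greedy_points :: "block_tree \<Rightarrow> point set" where
  "leaf_greedy_points w = {(b, t). b \<in> keys P w \<and> t \<in> times w \<and> greedy_at b t}"

lemma card_leaf_greedy_points:
  assumes "w \<in> set (nodes T)" "is_leaf w"
  shows "card (leaf_greedy_points w) \<le> greedy (leaf_perm P w)"
proof -
  let ?rs = "map (access P) [first_time w..<Suc (last_time w)]"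
  let ?Gr = "greedy_output ?rs (length ?rs)" and ?g = "\<lambda>(b, t). (b, Suc t - first_time w)"
  have "inj_on ?g (leaf_greedy_points w)"
    by (rule inj_onI) (auto simp: leaf_greedy_points_def times_def)
  moreover have "?g ` leaf_greedy_points w \<subseteq> ?Gr"
    using leaf_greedy_iff[OF assms] unfolding leaf_greedy_points_def by auto
  moreover have "finite ?Gr"
    using greedy_output_subset[of "length ?rs" ?rs] by (rule finite_subset) simp_all
  ultimately have "card (leaf_greedy_points w) \<le> card ?Gr" by (rule card_inj_on_le)
  then show ?thesis unfolding leaf_perm_def greedy_pattern by (simp only: greedy_def)
qed

definition leaf_end_points :: "point set" where
  "leaf_end_points = (\<Union>w\<in>set (leaf_nodes T). keys P w \<times> {last_time w})"

text \<open>Distinct leaves have disjoint keys, so each column is counted for at most one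
  leaf.\<close>

lemma card_leaf_end_points: "card leaf_end_points \<le> n"
proof -
  have "inj_on fst leaf_end_points"
  proof (rule inj_onI)
    fix z z' assume z: "z \<in> leaf_end_points" "z' \<in> leaf_end_points" "fst z = fst z'"
    obtain w where w: "w \<in> set (nodes T)" "is_leaf w" "fst z \<in> keys P w" "snd z = last_time w"
      using z(1) unfolding leaf_end_points_def leaf_nodes_def by auto
    obtain w' where w': "w' \<in> set (nodes T)" "is_leaf w'" "fst z' \<in> keys P w'" "snd z' = last_time w'"
      using z(2) unfolding leaf_end_points_def leaf_nodes_def by auto
    obtain t where "t \<in> times w" "t \<in> times w'"
      using common_key_time[OF w(1) w'(1) w(3)] w'(3) z(3) by metis
    then have "w \<in> set (nodes w') \<or> w' \<in> set (nodes w)" by (rule laminar[OF w(1) w'(1)])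
    then have "w = w'"
      using w(2) w'(2) set_nodes[of w] set_nodes[of w'] unfolding is_leaf_def by auto
    then show "z = z'" using w(4) w'(4) z(3) by (simp add: prod_eq_iff)
  qed
  moreover have "fst ` leaf_end_points \<subseteq> {1..n}"
    using keys_subset unfolding leaf_end_points_def leaf_nodes_def by fastforce
  ultimately have "card leaf_end_points \<le> card {1..n}" by (rule card_inj_on_le) simp
  then show ?thesis by simp
qed

definition extreme_key :: "block_tree \<Rightarrow> bool \<Rightarrow> nat" where
  "extreme_key c p = (if p then Min (keys P c) else Max (keys P c))"

definition active_pairs :: "block_tree \<Rightarrow> (nat \<times> nat) set" where
  "active_pairs v = {(i, j). active v i j \<and> i \<noteq> j}"

lemma finite_active_pairs: "finite (active_pairs v)"
  by (rule finite_subset[of _ "{..<length (children v)} \<times> {..<length (children v)}"])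
    (auto simp: active_pairs_def active_def)

text \<open>A superset of what is charged to \<open>v\<close>: the four combinations of outermost
  column and first or last time for each active region off the diagonal, and the outermost columns
  of all children at the end of \<open>v\<close>, where ancestors may act. Diagonal regions are left
  to deeper nodes.\<close>

definition node_points :: "block_tree \<Rightarrow> point set" where
  "node_points v =
     (\<lambda>((i, j), p, q). (extreme_key (children v ! i) p,
        if q then first_time (children v ! j) else last_time (children v ! j))) ` (active_pairs v \<times> UNIV \<times> UNIV) \<union>
     (\<lambda>(i, p). (extreme_key (children v ! i) p, last_time v)) ` ({..<length (children v)} \<times> UNIV)"

text \<open>
  A child's own diagonal region contributes a point to the skeleton's output but none to
  \<open>node_points\<close>; this slack pays for the points at the last time of \<open>v\<close>.
\<close>

lemma card_node_points:
  assumes "v \<in> set (nodes T)"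
  shows "card (node_points v) \<le> 4 * greedy (skeleton P v)"
proof -
  let ?k = "length (children v)" and ?g = "\<lambda>(i, j). (Min (keys P (children v ! i)), Suc j)"
  let ?D = "(\<lambda>j. (j, j)) ` {..<?k}"
  have "active_pairs v \<inter> ?D = {}" by (auto simp: active_pairs_def)
  then have "card (active_pairs v \<union> ?D) = card (active_pairs v) + ?k"
    by (simp add: card_Un_disjoint card_image inj_on_def finite_active_pairs)
  moreover have "card (active_pairs v \<union> ?D) \<le> card (skeleton_output v)"
  proof (rule card_inj_on_le)
    have bounds: "i < ?k" if "(i, j) \<in> active_pairs v \<union> ?D" for i j
      using that by (auto simp: active_pairs_def active_def)
    show "inj_on ?g (active_pairs v \<union> ?D)"
    proof (rule inj_onI)
      fix z z' assume z: "z \<in> active_pairs v \<union> ?D" "z' \<in> active_pairs v \<union> ?D" "?g z = ?g z'"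
      obtain i j i' j' where ij: "z = (i, j)" "z' = (i', j')" by (cases z, cases z')
      have "Min (keys P (children v ! i)) = Min (keys P (children v ! i'))" using z(3) unfolding ij by simp
      then have "i = i'"
        using Min_keys_inj[OF assms bounds[OF z(1)[unfolded ij]] bounds[OF z(2)[unfolded ij]]] by blast
      then show "z = z'" using z(3) unfolding ij by simp
    qed
    show "?g ` (active_pairs v \<union> ?D) \<subseteq> skeleton_output v"
      using active_self unfolding active_pairs_def active_def by auto
    show "finite (skeleton_output v)"
      unfolding skeleton_output_def
      by (rule finite_subset[OF greedy_output_subset]) simp_all
  qed
  ultimately have le: "card (active_pairs v) + ?k \<le> greedy (skeleton P v)"
    by (simp add: card_skeleton_output)
  have "card (node_points v) \<le>
      card (active_pairs v \<times> (UNIV :: bool set) \<times> (UNIV :: bool set)) + card ({..<?k} \<times> (UNIV :: bool set))"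
    unfolding node_points_def
    by (intro order.trans[OF card_Un_le] add_mono card_image_le)
       (simp_all add: finite_active_pairs)
  also have "\<dots> = 4 * card (active_pairs v) + 2 * ?k" 
    by (simp add: card_cartesian_product UNIV_Times_UNIV[symmetric] del: UNIV_Times_UNIV)
  finally show ?thesis using le by simp
qed

lemma out_cover:
  "out \<subseteq> (\<Union>v\<in>set (non_leaf_nodes T). node_points v) \<union> (\<Union>w\<in>set (leaf_nodes T). leaf_greedy_points w) \<union>
     leaf_end_points \<union> later_greedy_outside"
proof (rule subrelI)
  fix b t assume bt: "(b, t) \<in> out"
  let ?cover = "(\<Union>v\<in>set (non_leaf_nodes T). node_points v) \<union> (\<Union>w\<in>set (leaf_nodes T). leaf_greedy_points w) \<union>
     leaf_end_points \<union> later_greedy_outside"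
  have "b \<in> {1..n}" "t \<in> {1..n}" using bt out_subset by blast+
  then show "(b, t) \<in> ?cover"
  proof (rule deepest_node)
    fix w assume w: "w \<in> set (nodes T)" "is_leaf w" "b \<in> keys P w" "t \<in> times w"
    then have wl: "w \<in> set (leaf_nodes T)" by (simp add: leaf_nodes_def)
    show ?thesis
    proof (cases "greedy_at b t")
      case True
      then have "(b, t) \<in> leaf_greedy_points w" using w by (simp add: leaf_greedy_points_def)
      then show ?thesis using wl by blast
    next
      case False
      then have "t = last_time w" using non_greedy_time[OF w(1,4) bt] w(2) by blast
      then have "(b, t) \<in> leaf_end_points" using wl w(3) unfolding leaf_end_points_def by blast
      then show ?thesis by blast
    qed
  next
    fix v i j assume v: "v \<in> set (nodes T)" "\<not> is_leaf v"
      and ij: "i < length (children v)" "j < length (children v)" "i \<noteq> j"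
      and b: "b \<in> keys P (children v ! i)" and t: "t \<in> times (children v ! j)"
    let ?c = "children v ! i" and ?w = "children v ! j"
    have vn: "v \<in> set (non_leaf_nodes T)" using v by (simp add: non_leaf_nodes_def)
    have w: "?w \<in> set (nodes T)" using child_in_nodes[OF v(1) ij(2)] .
    have "first_time ?c \<le> t" using out_key_first_time[OF bt child_in_nodes[OF v(1) ij(1)] b] .
    moreover have "t \<le> last_time ?w" "first_time ?w \<le> t" using t by (auto simp: times_def)
    \<comment> \<open>A column holds no point before its block starts, so child \<open>i\<close>
      precedes child \<open>j\<close> and has ended by time \<open>t\<close>; only its outermost
      columns can still receive points.\<close>
    ultimately have late: "last_time ?c < t"
      using children_less[OF v(1) _ ij(1), of j] children_less[OF v(1) _ ij(2), of i] ij(3) by linarith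
    have "b = Min (keys P ?c) \<or> b = Max (keys P ?c)"
      using middle_column_inactive[OF v(1) ij(1) b _ _ bt] late by linarith
    then obtain p where p: "b = extreme_key ?c p"
      unfolding extreme_key_def by (metis (full_types))
    have active_point: "(b, t) \<in> node_points v" if "active v i j" "t = first_time ?w \<or> t = last_time ?w"
    proof -
      have "\<exists>q. t = (if q then first_time ?w else last_time ?w)" using that(2) by (metis (full_types))
      then obtain q where q: "t = (if q then first_time ?w else last_time ?w)" ..
      have "((i, j), p, q) \<in> active_pairs v \<times> UNIV \<times> UNIV" using that(1) ij(3) by (simp add: active_pairs_def)
      then show ?thesis unfolding node_points_def using p q by (intro UnI1 image_eqI[of _ _ "((i, j), p, q)"]) auto
    qed
    show ?thesis using v(1) ij b t bt
    proof (rule sibling_point_cases)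
      assume g: "greedy_at b t"
      show ?thesis
      proof (cases "t = first_time ?w")
        case True
        have "active v i j" using active_regionI[OF v(1) ij b t] g by blast
        then show ?thesis using active_point True vn by blast
      next
        case False
        then have "first_time ?w < t" using t by (simp add: times_def)
        moreover have "b \<notin> keys P ?w" using child_key_unique[OF v(1) ij(1,2) b] ij(3) by blast
        ultimately have "(b, t) \<in> later_greedy_outside"
          unfolding later_greedy_outside_def using g w t out_time[OF bt] by blast
        then show ?thesis by blast
      qed
    next
      assume "t = last_time v"
      then have "(b, t) \<in> node_points v"
        unfolding node_points_def using p ij(1) by (intro UnI2 image_eqI[of _ _ "(i, p)"]) auto
      then show ?thesis using vn by blast
    next
      fix s assume s: "t = last_time ?w" "s < t" "s \<in> times ?w" "(b, s) \<in> out"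
      have "t \<in> times v" using child_times_subset[OF v(1) ij(2)] t by blast
      \<comment> \<open>At \<open>t\<close>, possibly the last time of \<open>v\<close>, an output
        point need not make the region active; the earlier point at \<open>s\<close> in the same
        region does.\<close>
      then have "s < last_time v" using s(2) by (simp add: times_def)
      then have "active v i j" using active_regionI[OF v(1) ij b s(3)] s(4) by blast
      then show ?thesis using active_point s(1) vn by blast
    qed
  qed
qed

lemma rgreedy_bound:
  "rgreedy P T \<le> 4 * (\<Sum>v\<leftarrow>non_leaf_nodes T. greedy (skeleton P v)) +
     (\<Sum>v\<leftarrow>leaf_nodes T. greedy (leaf_perm P v)) + 3 * n"
proof -
  let ?N = "\<Union>v\<in>set (non_leaf_nodes T). node_points v"
  let ?L = "\<Union>w\<in>set (leaf_nodes T). leaf_greedy_points w"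
  have "card ?N \<le> (\<Sum>v\<leftarrow>non_leaf_nodes T. card (node_points v))"
    by (rule card_UN_set_le_sum_list)
  also have "\<dots> \<le> (\<Sum>v\<leftarrow>non_leaf_nodes T. 4 * greedy (skeleton P v))"
    by (rule sum_list_mono) (simp add: non_leaf_nodes_def card_node_points)
  also have "\<dots> = 4 * (\<Sum>v\<leftarrow>non_leaf_nodes T. greedy (skeleton P v))"
    by (simp add: sum_list_const_mult)
  finally have N: "card ?N \<le> 4 * (\<Sum>v\<leftarrow>non_leaf_nodes T. greedy (skeleton P v))" .
  have "card ?L \<le> (\<Sum>w\<leftarrow>leaf_nodes T. card (leaf_greedy_points w))"
    by (rule card_UN_set_le_sum_list)
  also have "\<dots> \<le> (\<Sum>w\<leftarrow>leaf_nodes T. greedy (leaf_perm P w))"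
    by (rule sum_list_mono) (simp add: leaf_nodes_def card_leaf_greedy_points)
  finally have L: "card ?L \<le> (\<Sum>w\<leftarrow>leaf_nodes T. greedy (leaf_perm P w))" .
  have fin: "finite ?N" "finite ?L" "finite leaf_end_points" "finite later_greedy_outside"
  proof -
    show "finite ?N"
      by (simp add: node_points_def finite_active_pairs)
    show "finite ?L"
    proof (intro finite_UN_I finite_set)
      fix w show "finite (leaf_greedy_points w)"
        by (rule finite_subset[of _ "keys P w \<times> times w"]) (auto simp: leaf_greedy_points_def times_def)
    qed
    show "finite leaf_end_points" by (simp add: leaf_end_points_def)
    show "finite later_greedy_outside"
      using finite_out by (rule finite_subset[rotated]) (auto simp: later_greedy_outside_def greedy_at_out)
  qed
  have "card out \<le> card (?N \<union> ?L \<union> leaf_end_points \<union> later_greedy_outside)"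
    using out_cover fin by (intro card_mono) blast+
  also have "\<dots> \<le> card ?N + card ?L + card leaf_end_points + card later_greedy_outside"
    by (intro order.trans[OF card_Un_le] add_mono order.refl)
  also have "\<dots> \<le> 4 * (\<Sum>v\<leftarrow>non_leaf_nodes T. greedy (skeleton P v)) +
     (\<Sum>w\<leftarrow>leaf_nodes T. greedy (leaf_perm P w)) + n + 2 * n"
    by (intro add_mono N L card_leaf_end_points card_later_greedy_outside)
  finally show ?thesis unfolding rgreedy_def length_P out_def[symmetric] by simp
qed

end

theorem mainTheorem8:
  fixes n :: nat and P :: "nat list" and T :: block_tree
  assumes "P \<in> permutations_of_set {1..n}"
    and "block_decomposition_tree P T"
  shows "rgreedy P T \<le>
           4 * (\<Sum>v\<leftarrow>non_leaf_nodes T. greedy (skeleton P v)) +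
           (\<Sum>v\<leftarrow>leaf_nodes T. greedy (leaf_perm P v)) + 3 * n"
proof -
  interpret decomposed_permutation n P T by standard fact+
  show ?thesis by (rule rgreedy_bound)
qed

end
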